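(* Let $\sigma$ be the order $3$ automorphism of $\mathfrak{so}(8)$ defined in the context. Under $\sigma$, the basis $\{\mathrm{Tr}(M^2),\mathrm{Tr}(M^4),\mathrm{Tr}(M^6),\mathrm{Pf}(M)\}$ of generators of the algebra of invariant polynomials $\mathbb{C}[\mathfrak{so}(8)]^{\mathrm{SO}(8)}$ transforms as follows: for all $M\in\mathfrak{so}(8)$, $$\mathrm{Tr}(\sigma(M)^2)=\mathrm{Tr}(M^2),$$ $$\mathrm{Tr}(\sigma(M)^4)=\tfrac{3}{8}\,\mathrm{Tr}(M^2)^2-\tfrac12\,\mathrm{Tr}(M^4)-12\,\mathrm{Pf}(M),$$ $$\mathrm{Pf}(\sigma(M))=-\tfrac{1}{64}\,\mathrm{Tr}(M^2)^2+\tfrac{1}{16}\,\mathrm{Tr}(M^4)-\tfrac12\,\mathrm{Pf}(M),$$ $$\mathrm{Tr}(\sigma(M)^6)=\tfrac{15}{64}\,\mathrm{Tr}(M^2)^3-\tfrac{15}{16}\,\mathrm{Tr}(M^2)\,\mathrm{Tr}(M^4)-\tfrac{15}{2}\,\mathrm{Tr}(M^2)\,\mathrm{Pf}(M)+\mathrm{Tr}(M^6).$$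
   Context: $\mathfrak{so}(8)$ is the Lie algebra of skew-symmetric $8\times 8$ matrices $M=(M_{ij})_{0\le i,j\le 7}$, with rows and columns indexed by $0,\dots,7$ and with complex entries (the complexification of the real Lie algebra $\mathfrak{so}(8,\mathbb{R})$). For distinct $i,j$, $G_{i,j}$ is the matrix with $(i,j)$ entry $1$, $(j,i)$ entry $-1$ and all other entries $0$ (so $G_{j,i}=-G_{i,j}$), and $M=\sum_{i<j}M_{ij}G_{i,j}$. As a vector space $\mathfrak{so}(8)$ is the direct sum, over $i=1,\dots,7$, of the 4-dimensional subspaces with ordered bases $$(G_{0,i},\,G_{i+1,i+3},\,G_{i+2,i+6},\,G_{i+4,i+5}),$$ where the indices $i+k$ are taken mod 7 with representatives in $\{1,\dots,7\}$ (the index $0$ is not reduced). The linear map $\sigma:\mathfrak{so}(8)\to\mathfrak{so}(8)$ acts on each of these seven subspaces by sending the vector with coordinate column $x$ in the given basis to the vector with coordinate column $\mathcal{M}x$, where $$\mathcal{M}=\frac12\begin{pmatrix}-1&-1&-1&-1\\1&1&-1&-1\\1&-1&1&-1\\1&-1&-1&1\end{pmatrix}.$$ Equivalently, for $X=\sigma(M)$ and each $i$, the column $(X_{0,i},X_{i+1,i+3},X_{i+2,i+6},X_{i+4,i+5})^{T}$ equals $\mathcal{M}\,(M_{0,i},M_{i+1,i+3},M_{i+2,i+6},M_{i+4,i+5})^{T}$. The map $\sigma$ is a Lie algebra automorphism of order 3. The Pfaffian is normalized by $$\mathrm{Pf}(M)=\frac{1}{4!\cdot 2^4}\sum_{\eta\in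 S_8}\mathrm{sgn}(\eta)\,M_{\eta(0)\eta(1)}M_{\eta(2)\eta(3)}M_{\eta(4)\eta(5)}M_{\eta(6)\eta(7)},$$ where $S_8$ is the group of permutations of $\{0,\dots,7\}$. $\mathbb{C}[\mathfrak{so}(8)]^{\mathrm{SO}(8)}$ denotes the algebra of polynomial functions on $\mathfrak{so}(8)$ invariant under conjugation by $\mathrm{SO}(8)$; it is freely generated by $\mathrm{Tr}(M^2),\mathrm{Tr}(M^4),\mathrm{Tr}(M^6),\mathrm{Pf}(M)$. *)

theory Defs
  imports "HOL-Analysis.Analysis"
begin

text \<open>
  The rows and columns of a matrix are indexed by the numeral type \<^typ>\<open>8\<close>, whose elements are
  \<open>0, 1, \<dots>, 7\<close>. Its arithmetic is modulo 8, so the index arithmetic modulo 7 below is carried out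
  on \<^typ>\<open>nat\<close> and the result embedded by \<^const>\<open>of_nat\<close>.
\<close>

type_synonym mat8 = "complex^8^8"

definition so8 :: "mat8 set" where
  "so8 = {M. transpose M = - M}"

text \<open>
  Multiplication and \<open>^\<close> of the type class \<^class>\<open>power\<close> act componentwise on vectors, so powers
  with respect to the matrix product need a definition of their own.
\<close>

definition mat_power :: "mat8 \<Rightarrow> nat \<Rightarrow> mat8" where
  "mat_power M k = (((**) M) ^^ k) (mat 1)"

definition cmul :: "complex \<Rightarrow> mat8 \<Rightarrow> mat8" where
  "cmul c M = (\<chi> r s. c * M $ r $ s)"

definition G :: "8 \<Rightarrow> 8 \<Rightarrow> mat8" where
  "G i j = (\<chi> r s. if r = i \<and> s = j then 1 else if r = j \<and> s = i then - 1 else 0)"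

text \<open>The representative of \<open>n\<close> modulo 7 in \<open>{1, \<dots>, 7}\<close>, for \<open>n \<ge> 1\<close>.\<close>

definition ix :: "nat \<Rightarrow> 8" where
  "ix n = of_nat ((n - 1) mod 7 + 1)"

text \<open>
  The index pairs \<open>(a, b)\<close> of the ordered basis of matrices \<open>G a b\<close> of the \<open>i\<close>-th summand,
  \<open>1 \<le> i \<le> 7\<close>. The components of a vector of type \<open>_^4\<close> built by \<^const>\<open>vector\<close> are numbered from 1.
\<close>

definition block_pairs :: "nat \<Rightarrow> (8 \<times> 8)^4" where
  "block_pairs i = vector
     [(0, ix i), (ix (i + 1), ix (i + 3)), (ix (i + 2), ix (i + 6)), (ix (i + 4), ix (i + 5))]"

definition block_basis :: "nat \<Rightarrow> mat8^4" where
  "block_basis i = (\<chi> k. case block_pairs i $ k of (a, b) \<Rightarrow> G a b)"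

definition block_coords :: "mat8 \<Rightarrow> nat \<Rightarrow> complex^4" where
  "block_coords M i = (\<chi> k. case block_pairs i $ k of (a, b) \<Rightarrow> M $ a $ b)"

definition sigma_matrix :: "complex^4^4" where
  "sigma_matrix = (1/2) *\<^sub>R vector
     [vector [-1, -1, -1, -1],
      vector [ 1,  1, -1, -1],
      vector [ 1, -1,  1, -1],
      vector [ 1, -1, -1,  1]]"

definition so8_sigma :: "mat8 \<Rightarrow> mat8" where
  "so8_sigma M = (\<Sum>i=1..7. \<Sum>k\<in>UNIV. cmul ((sigma_matrix *v block_coords M i) $ k) (block_basis i $ k))"

definition Pf :: "mat8 \<Rightarrow> complex" where
  "Pf M = 1 / (fact 4 * 2 ^ 4) *
     (\<Sum>\<eta> | \<eta> permutes (UNIV :: 8 set).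
        of_int (sign \<eta>) * M $ \<eta> 0 $ \<eta> 1 * M $ \<eta> 2 $ \<eta> 3 * M $ \<eta> 4 $ \<eta> 5 * M $ \<eta> 6 $ \<eta> 7)"

lemma vector_4: "(vector [w, x, y, z] :: 'a::zero^4) $ 1 = w" "(vector [w, x, y, z] :: 'a::zero^4) $ 2 = x"
  "(vector [w, x, y, z] :: 'a::zero^4) $ 3 = y" "(vector [w, x, y, z] :: 'a::zero^4) $ 4 = z"
  unfolding vector_def by simp_all

lemma exhaust_8: fixes x :: 8 shows "x=0 \<or> x=1 \<or> x=2 \<or> x=3 \<or> x=4 \<or> x=5 \<or> x=6 \<or> x=7"
proof (induct x)
  case (of_int z)
  then have "z=0 \<or> z=1 \<or> z=2 \<or> z=3 \<or> z=4 \<or> z=5 \<or> z=6 \<or> z=7" by simp linarith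
  then show ?case by auto
qed

lemma forall_8: "(\<forall>x::8. P x) \<longleftrightarrow> P 0 \<and> P 1 \<and> P 2 \<and> P 3 \<and> P 4 \<and> P 5 \<and> P 6 \<and> P 7"
  by (metis exhaust_8)

lemma UNIV_8: "(UNIV :: 8 set) = {0,1,2,3,4,5,6,7}" using exhaust_8 by auto

lemma sum_8: "sum f (UNIV :: 8 set) = f 0 + f 1 + f 2 + f 3 + f 4 + f 5 + f 6 + f 7"
  unfolding UNIV_8 by (simp add: ac_simps)

lemma atLeastAtMost_1_7: "{1..7::nat} = {1,2,3,4,5,6,7}" "{Suc 0..7} = {1,2,3,4,5,6,7}" by auto

lemma ix_simps: "ix 1 = 1" "ix (Suc 0) = 1" "ix (Suc (Suc 0)) = 2" "ix (Suc (Suc (Suc 0))) = 3" 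
   "ix 2 = 2" "ix 3 = 3" "ix 4 = 4" "ix 5 = 5" "ix 6 = 6" "ix 7 = 7"
 "ix 8 = 1" "ix 9 = 2" "ix 10 = 3" "ix 11 = 4" "ix 12 = 5" "ix 13 = 6"
  by (simp_all add: ix_def)

lemma so8_iff: "M \<in> so8 \<longleftrightarrow> (\<forall>i j. M $ j $ i = - M $ i $ j)"
  by (auto simp: so8_def transpose_def vec_eq_iff)

text \<open>The skew-symmetric matrix whose coordinates in the \<open>i\<close>-th summand are \<open>c i\<close>.\<close>

definition so8_of :: "(nat \<Rightarrow> complex^4) \<Rightarrow> mat8" where
 "so8_of c = (\<Sum>i=1..7. \<Sum>k\<in>UNIV. cmul (c i $ k) (block_basis i $ k))"

lemma sum_mat8_nth: "(\<Sum>i\<in>A. f i :: mat8) $ r $ s = (\<Sum>i\<in>A. f i $ r $ s)" by simp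

lemma block_basis_nth: "block_basis i $ 1 = G 0 (ix i)" "block_basis i $ 2 = G (ix (i + 1)) (ix (i + 3))"
 "block_basis i $ 3 = G (ix (i + 2)) (ix (i + 6))" "block_basis i $ 4 = G (ix (i + 4)) (ix (i + 5))"
 by (simp_all add: block_basis_def block_pairs_def vector_4)

lemma block_coords_nth: "block_coords M i $ 1 = M $ 0 $ (ix i)" "block_coords M i $ 2 = M $ (ix (i 
   + 1)) $ (ix (i + 3))"
 "block_coords M i $ 3 = M $ (ix (i + 2)) $ (ix (i + 6))" "block_coords M i $ 4 = M $ (ix (i + 4)) $ (ix (i + 5))"
 by (simp_all add: block_coords_def block_pairs_def vector_4)

lemma so8_of_nth: "so8_of c $ r $ s = (\<Sum>i\<in>{1,2,3,4,5,6,7}. c i $ 1 * G 0 (ix i) $ r $ s 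
   + c i $ 2 * G (ix (i + 1)) (ix (i + 3)) $ r $ s +
  c i $ 3 * G (ix (i + 2)) (ix (i + 6)) $ r $ s + c i $ 4 * G (ix (i + 4)) (ix (i + 5)) $ r $ s)"
  unfolding so8_of_def sum_mat8_nth atLeastAtMost_1_7 sum_4 block_basis_nth cmul_def by simp

lemma so8_of_nth_expanded: "so8_of c $ r $ s = c 1 $ 1 * G 0 1 $ r $ s + c 1 $ 2 * G 2 4 $ r $ s 
   + c 1 $ 3 * G 3 7 $ r $ s + c 1 $ 4 * G 5 6 $ r $ s + c 2 $ 1 * G 0 2 $ r $ s + c 2 $ 2 * G 3 5 $ r $ s 
   + c 2 $ 3 * G 4 1 $ r $ s + c 2 $ 4 * G 6 7 $ r $ s + c 3 $ 1 * G 0 3 $ r $ s + c 3 $ 2 * G 4 6 $ r $ s 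
   + c 3 $ 3 * G 5 2 $ r $ s + c 3 $ 4 * G 7 1 $ r $ s + c 4 $ 1 * G 0 4 $ r $ s + c 4 $ 2 * G 5 7 $ r $ s 
   + c 4 $ 3 * G 6 3 $ r $ s + c 4 $ 4 * G 1 2 $ r $ s + c 5 $ 1 * G 0 5 $ r $ s + c 5 $ 2 * G 6 1 $ r $ s 
   + c 5 $ 3 * G 7 4 $ r $ s + c 5 $ 4 * G 2 3 $ r $ s + c 6 $ 1 * G 0 6 $ r $ s + c 6 $ 2 * G 7 2 $ r $ s 
   + c 6 $ 3 * G 1 5 $ r $ s + c 6 $ 4 * G 3 4 $ r $ s + c 7 $ 1 * G 0 7 $ r $ s + c 7 $ 2 * G 1 3 $ r $ s 
   + c 7 $ 3 * G 2 6 $ r $ s + c 7 $ 4 * G 4 5 $ r $ s"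
  unfolding so8_of_nth by (simp add: ix_simps)

lemma so8_of_entries: 
  "so8_of c $ 0 $ 0 = 0" "so8_of c $ 0 $ 1 = c 1 $ 1" "so8_of c $ 0 $ 2 = c 2 $ 1"
  "so8_of c $ 0 $ 3 = c 3 $ 1" "so8_of c $ 0 $ 4 = c 4 $ 1" "so8_of c $ 0 $ 5 = c 5 $ 1"
  "so8_of c $ 0 $ 6 = c 6 $ 1" "so8_of c $ 0 $ 7 = c 7 $ 1" "so8_of c $ 1 $ 0 = - (c 1 $ 1)"
  "so8_of c $ 1 $ 1 = 0" "so8_of c $ 1 $ 2 = c 4 $ 4" "so8_of c $ 1 $ 3 = c 7 $ 2"
  "so8_of c $ 1 $ 4 = - (c 2 $ 3)" "so8_of c $ 1 $ 5 = c 6 $ 3" "so8_of c $ 1 $ 6 = - (c 5 $ 2)"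
  "so8_of c $ 1 $ 7 = - (c 3 $ 4)" "so8_of c $ 2 $ 0 = - (c 2 $ 1)" "so8_of c $ 2 $ 1 = - (c 4 $ 4)"
  "so8_of c $ 2 $ 2 = 0" "so8_of c $ 2 $ 3 = c 5 $ 4" "so8_of c $ 2 $ 4 = c 1 $ 2"
  "so8_of c $ 2 $ 5 = - (c 3 $ 3)" "so8_of c $ 2 $ 6 = c 7 $ 3" "so8_of c $ 2 $ 7 = - (c 6 $ 2)"
  "so8_of c $ 3 $ 0 = - (c 3 $ 1)" "so8_of c $ 3 $ 1 = - (c 7 $ 2)" "so8_of c $ 3 $ 2 = - (c 5 $ 4)"
  "so8_of c $ 3 $ 3 = 0" "so8_of c $ 3 $ 4 = c 6 $ 4" "so8_of c $ 3 $ 5 = c 2 $ 2"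
  "so8_of c $ 3 $ 6 = - (c 4 $ 3)" "so8_of c $ 3 $ 7 = c 1 $ 3" "so8_of c $ 4 $ 0 = - (c 4 $ 1)"
  "so8_of c $ 4 $ 1 = c 2 $ 3" "so8_of c $ 4 $ 2 = - (c 1 $ 2)" "so8_of c $ 4 $ 3 = - (c 6 $ 4)"
  "so8_of c $ 4 $ 4 = 0" "so8_of c $ 4 $ 5 = c 7 $ 4" "so8_of c $ 4 $ 6 = c 3 $ 2"
  "so8_of c $ 4 $ 7 = - (c 5 $ 3)" "so8_of c $ 5 $ 0 = - (c 5 $ 1)" "so8_of c $ 5 $ 1 = - (c 6 $ 3)"
  "so8_of c $ 5 $ 2 = c 3 $ 3" "so8_of c $ 5 $ 3 = - (c 2 $ 2)" "so8_of c $ 5 $ 4 = - (c 7 $ 4)"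
  "so8_of c $ 5 $ 5 = 0" "so8_of c $ 5 $ 6 = c 1 $ 4" "so8_of c $ 5 $ 7 = c 4 $ 2"
  "so8_of c $ 6 $ 0 = - (c 6 $ 1)" "so8_of c $ 6 $ 1 = c 5 $ 2" "so8_of c $ 6 $ 2 = - (c 7 $ 3)"
  "so8_of c $ 6 $ 3 = c 4 $ 3" "so8_of c $ 6 $ 4 = - (c 3 $ 2)" "so8_of c $ 6 $ 5 = - (c 1 $ 4)"
  "so8_of c $ 6 $ 6 = 0" "so8_of c $ 6 $ 7 = c 2 $ 4" "so8_of c $ 7 $ 0 = - (c 7 $ 1)"
  "so8_of c $ 7 $ 1 = c 3 $ 4" "so8_of c $ 7 $ 2 = c 6 $ 2" "so8_of c $ 7 $ 3 = - (c 1 $ 3)"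
  "so8_of c $ 7 $ 4 = c 5 $ 3" "so8_of c $ 7 $ 5 = - (c 4 $ 2)" "so8_of c $ 7 $ 6 = - (c 2 $ 4)"
  "so8_of c $ 7 $ 7 = 0"
 unfolding so8_of_nth_expanded G_def by simp_all

lemma so8_sigma_eq_so8_of: "so8_sigma M = so8_of (\<lambda>i. sigma_matrix *v block_coords M i)" unfolding so8_sigma_def so8_of_def ..

lemma so8_of_in_so8: "so8_of c \<in> so8" unfolding so8_iff forall_8 so8_of_entries by simp

lemma block_coords_so8_of: assumes "i \<in> {1..7}" shows "block_coords (so8_of c) i = c i"
proof -
  have "\<forall>i\<in>{1,2,3,4,5,6,7}. \<forall>k. block_coords (so8_of c) i $ k = c i $ k"
   unfolding forall_4 block_coords_nth by (simp add: ix_simps so8_of_entries)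
  then show ?thesis using assms unfolding atLeastAtMost_1_7(1) vec_eq_iff by blast
qed

lemma so8_of_block_coords: assumes "M \<in> so8" shows "so8_of (block_coords M) = M"
proof -
  have s: "M $ j $ i = - M $ i $ j" for i j using assms so8_iff by blast
  have d: "M $ i $ i = 0" for i using s[of i i] by simp
  show ?thesis unfolding vec_eq_iff forall_8 so8_of_entries block_coords_nth
   by (simp add: ix_simps d) (intro conjI; (rule s | rule s[symmetric]))
qed

lemma sigma_matrix_entries: "sigma_matrix $ 1 $ 1 = - 1/2" "sigma_matrix $ 1 $ 2 = - 1/2" 
   "sigma_matrix $ 1 $ 3 = - 1/2" "sigma_matrix $ 1 $ 4 = - 1/2" "sigma_matrix $ 2 $ 1 =  1/2" 
   "sigma_matrix $ 2 $ 2 =  1/2" "sigma_matrix $ 2 $ 3 = - 1/2" "sigma_matrix $ 2 $ 4 = - 1/2" 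
   "sigma_matrix $ 3 $ 1 =  1/2" "sigma_matrix $ 3 $ 2 = - 1/2" "sigma_matrix $ 3 $ 3 =  1/2" 
   "sigma_matrix $ 3 $ 4 = - 1/2" "sigma_matrix $ 4 $ 1 =  1/2" "sigma_matrix $ 4 $ 2 = - 1/2" 
   "sigma_matrix $ 4 $ 3 = - 1/2" "sigma_matrix $ 4 $ 4 =  1/2"
 unfolding sigma_matrix_def vector_scaleR_component vector_4 by (simp_all add: scaleR_conv_of_real)

lemma sigma_matrix_cube: "sigma_matrix ** sigma_matrix ** sigma_matrix = mat 1"
  by (simp add: vec_eq_iff forall_4 matrix_matrix_mult_def sum_4 sigma_matrix_entries mat_def scaleR_conv_of_real)

lemma so8_of_cong: "(\<And>i. i \<in> {1..7} \<Longrightarrow> c i = d i) \<Longrightarrow> so8_of c = so8_of d" unfolding so8_of_def by (intro sum.cong) auto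

lemma so8_sigma_cube: assumes "M \<in> so8" shows "so8_sigma (so8_sigma (so8_sigma M)) = M"
proof -
  have "so8_sigma (so8_sigma (so8_sigma M)) = so8_of (block_coords M)"
    unfolding so8_sigma_eq_so8_of
    by (rule so8_of_cong) (simp add: block_coords_so8_of matrix_vector_mul_assoc sigma_matrix_cube[unfolded matrix_mul_assoc[symmetric]] matrix_mul_assoc[symmetric] del: atLeastAtMost_iff One_nat_def)
  then show ?thesis using so8_of_block_coords[OF assms] by simp
qed

corollary so8_sigma_in_so8: "so8_sigma M \<in> so8"
  unfolding so8_sigma_eq_so8_of by (rule so8_of_in_so8)

corollary block_coords_so8_sigma:
  "i \<in> {1..7} \<Longrightarrow> block_coords (so8_sigma M) i = sigma_matrix *v block_coords M i"
  unfolding so8_sigma_eq_so8_of by (rule block_coords_so8_of)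

lemma so8_sigma_neq_id: "so8_sigma (G 0 1) \<noteq> G 0 1"
proof -
  have "so8_sigma (G 0 1) $ 0 $ 1 \<noteq> G 0 1 $ 0 $ 1"
    unfolding so8_sigma_eq_so8_of so8_of_entries
    by (simp add: matrix_vector_mult_def sum_4 block_coords_nth sigma_matrix_entries G_def ix_simps complex_eq_iff)
  then show ?thesis by auto
qed

end

theory Submission
  imports Defs "HOL-Complex_Analysis.Conformal_Mappings"
begin

text \<open>
  Each summand of dimension 4 is a Cartan subalgebra that \<open>\<sigma>\<close> preserves. If \<open>X\<close> lies in one of them and has
  coordinates \<open>\<plusminus>1\<close>, then \<open>X\<^sup>2 = -1\<close>, so \<open>cos t + sin t X\<close> is a one-parameter group in \<open>SO(8)\<close>. Because \<open>\<sigma>\<close>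
  respects brackets, it intertwines conjugation by this group with conjugation by the group of \<open>\<sigma> X\<close>, at
  least when \<open>\<sigma> X\<close> also has coordinates \<open>\<plusminus>1\<close>; such \<open>X\<close> span \<open>so(8)\<close>. Hence all invariants of \<open>N\<close> and of
  \<open>\<sigma> N\<close> are constant under these conjugations.

  For a real \<open>M\<close>, the real skew-symmetric \<open>N\<close> with the same invariants as \<open>M\<close> form a compact set. At a point
  where \<open>Tr (H N)\<close> is maximal, with \<open>H\<close> a regular element of the first summand, the derivatives along all
  \<open>X\<close> vanish, that is \<open>Tr (X [N, H]) = 0\<close>, so \<open>N\<close> commutes with \<open>H\<close> and lies in the first summand. There
  the relations are polynomial identities in four variables. Finally, \<open>Re M + z Im M\<close> is real for real \<open>z\<close>
  and equals \<open>M\<close> at \<open>z = \<i>\<close>, so the identity theorem extends the relations to complex matrices.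
\<close>

section \<open>Matrix algebra\<close>

definition commutator :: "'a::ring_1^'n^'n \<Rightarrow> 'a^'n^'n \<Rightarrow> 'a^'n^'n" where
  "commutator A B = A ** B - B ** A"

lemma matrix_diff_ldistrib: "A ** (B - C) = A ** B - A ** (C :: 'a::ring_1^'n^'m)"
  by (vector matrix_matrix_mult_def sum_subtractf algebra_simps)

lemma matrix_diff_rdistrib: "(A - B) ** C = A ** C - B ** (C :: 'a::ring_1^'n^'m)"
  by (vector matrix_matrix_mult_def sum_subtractf algebra_simps)

lemma matrix_minus_left: "(- A) ** B = - (A ** (B :: 'a::ring_1^'n^'m))"
  by (vector matrix_matrix_mult_def sum_negf)

lemma matrix_minus_right: "A ** (- B) = - (A ** (B :: 'a::ring_1^'n^'m))"
  by (vector matrix_matrix_mult_def sum_negf)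

lemma mat_power_Suc: "mat_power M (Suc k) = M ** mat_power M k"
  by (simp add: mat_power_def)

lemma mat_power_0: "mat_power M 0 = mat 1"
  by (simp add: mat_power_def)

text \<open>\<open>U\<close> intertwines the powers of \<open>N\<close> with those of its conjugate;
  cyclicity of the trace then brings \<open>V\<close> and \<open>U\<close> together.\<close>

lemma trace_mat_power_conj:
  assumes "V ** U = mat 1"
  shows "trace (mat_power (U ** N ** V) k) = trace (mat_power N k)"
proof -
  have *: "mat_power (U ** N ** V) k ** U = U ** mat_power N k" for k
  proof (induction k)
    case (Suc k)
    have "mat_power (U ** N ** V) (Suc k) ** U = U ** N ** V ** (mat_power (U ** N ** V) k ** U)"
      by (simp add: mat_power_Suc matrix_mul_assoc)
    also have "\<dots> = U ** N ** (V ** U) ** mat_power N k"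
      unfolding Suc.IH by (simp only: matrix_mul_assoc)
    finally show ?case by (simp add: assms mat_power_Suc matrix_mul_assoc)
  qed (simp add: mat_power_0)
  have "U ** V = mat 1" using assms matrix_left_right_inverse by blast
  then have "mat_power (U ** N ** V) k = mat_power (U ** N ** V) k ** U ** V"
    by (simp flip: matrix_mul_assoc)
  then have "mat_power (U ** N ** V) k = U ** (mat_power N k ** V)"
    by (simp only: * matrix_mul_assoc)
  then have "trace (mat_power (U ** N ** V) k) = trace (mat_power N k ** V ** U)"
    by (simp only: trace_mul_sym[of U])
  then show ?thesis by (simp add: assms flip: matrix_mul_assoc)
qed

lemma matrix_add_rdistrib: "(A + B) ** C = A ** C + B ** (C :: 'a::semiring_1^'n^'m)"
  by (vector matrix_matrix_mult_def sum.distrib[symmetric] field_simps)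

lemma scaleR_matrix_left: "(r *\<^sub>R A) ** (B :: mat8) = r *\<^sub>R (A ** B)"
  by (simp add: scalar_matrix_assoc)

lemma scaleR_matrix_right: "A ** (r *\<^sub>R (B :: mat8)) = r *\<^sub>R (A ** B)"
  by (simp add: matrix_matrix_mult_def vec_eq_iff scaleR_sum_right)

lemmas matrix_ring_simps = matrix_add_ldistrib matrix_add_rdistrib matrix_diff_ldistrib
  matrix_diff_rdistrib matrix_minus_left matrix_minus_right scaleR_matrix_left scaleR_matrix_right

section \<open>The Pfaffian under congruence\<close>

text \<open>The sign of \<open>f\<close> if \<open>f\<close> is a permutation and 0 otherwise. The
  form as a determinant makes the rules for rows and products available.\<close>

definition levi_civita :: "('n::finite \<Rightarrow> 'n) \<Rightarrow> 'a::comm_ring_1" where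
  "levi_civita f = det (\<chi> i j. if j = f i then 1 else 0)"

text \<open>The left side is the Leibniz expansion of the determinant of a product: the 0-1 matrix
  of \<open>f\<close> times \<open>transpose A\<close>.\<close>

lemma sum_permutes_eq_levi_civita:
  fixes A :: "'a::comm_ring_1^'n^'n"
  shows "(\<Sum>p\<in>{p. p permutes UNIV}. of_int (sign p) * (\<Prod>i\<in>UNIV. A $ p i $ f i)) = det A * levi_civita f"
proof -
  have "(\<Sum>p\<in>{p. p permutes UNIV}. of_int (sign p) * (\<Prod>i\<in>UNIV. A $ p i $ f i))
      = det ((\<chi> i j. if j = f i then 1 else 0) ** transpose A)"
    by (simp add: det_def matrix_matrix_mult_def transpose_def if_distrib[of "\<lambda>x. x * _"] cong: if_cong)
  then show ?thesis by (simp add: det_mul levi_civita_def)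
qed

lemma levi_civita_not_inj:
  assumes "i \<noteq> j" "f i = f j"
  shows "levi_civita f = (0 :: 'a :: {comm_ring_1})"
  unfolding levi_civita_def by (rule det_identical_rows[OF assms(1)]) (simp add: row_def assms)

lemma levi_civita_swap:
  assumes "i \<noteq> j"
  shows "levi_civita (f \<circ> Transposition.transpose i j) = - levi_civita f"
proof -
  have "levi_civita (f \<circ> Transposition.transpose i j)
      = det (\<chi> k. (\<chi> i j. if j = f i then 1 else 0) $ Transposition.transpose i j k :: 'b^'a^'a)"
    unfolding levi_civita_def by (intro arg_cong[where f=det]) (simp add: vec_eq_iff)
  also have "\<dots> = of_int (sign (Transposition.transpose i j)) * levi_civita f"
    unfolding levi_civita_def by (intro det_permute_rows permutes_swap_id) auto
  finally show ?thesis using assms by (simp add: sign_swap_id)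
qed

section \<open>The alternating symbol with eight indices\<close>

definition fun8 :: "8 \<Rightarrow> 8 \<Rightarrow> 8 \<Rightarrow> 8 \<Rightarrow> 8 \<Rightarrow> 8 \<Rightarrow> 8 \<Rightarrow> 8 \<Rightarrow> 8 \<Rightarrow> 8" where
  "fun8 a b c d e f g h i =
    (if i = 0 then a else if i = 1 then b else if i = 2 then c else if i = 3 then d else
     if i = 4 then e else if i = 5 then f else if i = 6 then g else h)"

definition eps8 :: "8 \<Rightarrow> 8 \<Rightarrow> 8 \<Rightarrow> 8 \<Rightarrow> 8 \<Rightarrow> 8 \<Rightarrow> 8 \<Rightarrow> 8 \<Rightarrow> complex" where
  "eps8 a b c d e f g h = levi_civita (fun8 a b c d e f g h)"

lemma prod_8: "prod f (UNIV :: 8 set) = f 0 * f 1 * f 2 * f 3 * f 4 * f 5 * f 6 * (f 7 :: 'a :: comm_monoid_mult)"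
  unfolding UNIV_8 by (simp add: ac_simps)

lemma fun8_simps: "fun8 a b c d e f g h 0 = a" "fun8 a b c d e f g h 1 = b"
  "fun8 a b c d e f g h 2 = c" "fun8 a b c d e f g h 3 = d" "fun8 a b c d e f g h 4 = e"
  "fun8 a b c d e f g h 5 = f" "fun8 a b c d e f g h 6 = g" "fun8 a b c d e f g h 7 = h"
  by (simp_all add: fun8_def)

lemma sum_permutes_eq_eps8:
  fixes A :: mat8
  shows "(\<Sum>p\<in>{p. p permutes (UNIV :: 8 set)}. of_int (sign p) * (A $ p 0 $ a * A $ p 1 $ b * A $ p 2 $ c *
    A $ p 3 $ d * A $ p 4 $ e * A $ p 5 $ f * A $ p 6 $ g * A $ p 7 $ h)) = det A * eps8 a b c d e f g h"
  using sum_permutes_eq_levi_civita[of A "fun8 a b c d e f g h"]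
  unfolding prod_8 fun8_simps eps8_def .


text \<open>\<open>W\<close> and \<open>Z\<close> collect the factors before and after the one being
  expanded, so the rule applies in turn to each of the four entries in the Pfaffian.\<close>

lemma sum_bilinear_swap:
  fixes B :: "'a::comm_ring_1^'n^'m"
  shows "(\<Sum>p\<in>P. W p * (\<Sum>a\<in>UNIV. \<Sum>b\<in>UNIV. B $ a $ b * (x p a * y p b)) * Z p)
    = (\<Sum>a\<in>UNIV. \<Sum>b\<in>UNIV. B $ a $ b * (\<Sum>p\<in>P. W p * (x p a * y p b) * Z p))"
proof -
  have "(\<Sum>p\<in>P. W p * (\<Sum>a\<in>UNIV. \<Sum>b\<in>UNIV. B $ a $ b * (x p a * y p b)) * Z p)
    = (\<Sum>p\<in>P. \<Sum>a\<in>UNIV. \<Sum>b\<in>UNIV. B $ a $ b * (W p * (x p a * y p b) * Z p))"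
    by (simp add: sum_distrib_left sum_distrib_right ac_simps)
  also have "\<dots> = (\<Sum>a\<in>UNIV. \<Sum>p\<in>P. \<Sum>b\<in>UNIV. B $ a $ b * (W p * (x p a * y p b) * Z p))"
    by (rule sum.swap)
  also have "\<dots> = (\<Sum>a\<in>UNIV. \<Sum>b\<in>UNIV. \<Sum>p\<in>P. B $ a $ b * (W p * (x p a * y p b) * Z p))"
    by (intro sum.cong refl sum.swap)
  finally show ?thesis by (simp add: sum_distrib_left)
qed

text \<open>Each entry of \<open>A ** M ** transpose A\<close> is bilinear in the rows of
  \<open>A\<close>. With the entries of \<open>M\<close> pulled out, the sum over permutations is a
  determinant from which \<open>det A\<close> splits off.\<close>

lemma Pf_conj_eq_eps8:
  "Pf (A ** M ** transpose A) = det A * (1 / (fact 4 * 2 ^ 4) *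
    (\<Sum>a\<in>UNIV. \<Sum>b\<in>UNIV. M $ a $ b * (\<Sum>c\<in>UNIV. \<Sum>d\<in>UNIV. M $ c $ d * (\<Sum>e\<in>UNIV. \<Sum>f\<in>UNIV. M $ e $ f *
     (\<Sum>g\<in>UNIV. \<Sum>h\<in>UNIV. M $ g $ h * eps8 a b c d e f g h)))))" (is "_ = det A * (_ * ?S)")
proof -
  have entry: "(A ** M ** transpose A) $ i $ j = (\<Sum>a\<in>UNIV. \<Sum>b\<in>UNIV. M $ a $ b * (A $ i $ a * A $ j $ b))" for i j
    unfolding matrix_matrix_mult_def transpose_def
    by (simp add: sum_distrib_left sum_distrib_right ac_simps) (subst sum.swap, rule refl)
  let ?E = "\<lambda>p i j. (A ** M ** transpose A) $ p i $ p j"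
  let ?P = "{p. p permutes (UNIV :: 8 set)}"
  have "(\<Sum>p\<in>?P. of_int (sign p) * ?E p 0 1 * ?E p 2 3 * ?E p 4 5 * ?E p 6 7)
    = (\<Sum>p\<in>?P. of_int (sign p) * ?E p 0 1 * (?E p 2 3 * ?E p 4 5 * ?E p 6 7))"
    by (simp only: mult.assoc)
  also have "\<dots> = (\<Sum>a\<in>UNIV. \<Sum>b\<in>UNIV. M $ a $ b *
      (\<Sum>p\<in>?P. of_int (sign p) * (A $ p 0 $ a * A $ p 1 $ b) * (?E p 2 3 * ?E p 4 5 * ?E p 6 7)))"
    unfolding entry[of "_ 0" "_ 1"] by (rule sum_bilinear_swap)
  also have "\<dots> = (\<Sum>a\<in>UNIV. \<Sum>b\<in>UNIV. M $ a $ b *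
      (\<Sum>p\<in>?P. of_int (sign p) * (A $ p 0 $ a * A $ p 1 $ b) * ?E p 2 3 * (?E p 4 5 * ?E p 6 7)))"
    by (simp only: mult.assoc)
  also have "\<dots> = (\<Sum>a\<in>UNIV. \<Sum>b\<in>UNIV. M $ a $ b * (\<Sum>c\<in>UNIV. \<Sum>d\<in>UNIV. M $ c $ d *
      (\<Sum>p\<in>?P. of_int (sign p) * (A $ p 0 $ a * A $ p 1 $ b) * (A $ p 2 $ c * A $ p 3 $ d) * (?E p 4 5 * ?E p 6 7))))"
    unfolding entry[of "_ 2" "_ 3"] by (subst sum_bilinear_swap) (rule refl)
  also have "\<dots> = (\<Sum>a\<in>UNIV. \<Sum>b\<in>UNIV. M $ a $ b * (\<Sum>c\<in>UNIV. \<Sum>d\<in>UNIV. M $ c $ d *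
      (\<Sum>p\<in>?P. of_int (sign p) * (A $ p 0 $ a * A $ p 1 $ b) * (A $ p 2 $ c * A $ p 3 $ d) * ?E p 4 5 * ?E p 6 7)))"
    by (simp only: mult.assoc)
  also have "\<dots> = (\<Sum>a\<in>UNIV. \<Sum>b\<in>UNIV. M $ a $ b * (\<Sum>c\<in>UNIV. \<Sum>d\<in>UNIV. M $ c $ d *
      (\<Sum>e\<in>UNIV. \<Sum>f\<in>UNIV. M $ e $ f * (\<Sum>p\<in>?P. of_int (sign p) * (A $ p 0 $ a * A $ p 1 $ b) *
        (A $ p 2 $ c * A $ p 3 $ d) * (A $ p 4 $ e * A $ p 5 $ f) * ?E p 6 7))))"
    unfolding entry[of "_ 4" "_ 5"] by (subst sum_bilinear_swap) (rule refl)
  \<comment> \<open>The factor 1 takes the place of \<open>Z\<close> in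
    \<open>sum_bilinear_swap\<close>, as nothing follows the last entry.\<close>
  also have "\<dots> = (\<Sum>a\<in>UNIV. \<Sum>b\<in>UNIV. M $ a $ b * (\<Sum>c\<in>UNIV. \<Sum>d\<in>UNIV. M $ c $ d *
      (\<Sum>e\<in>UNIV. \<Sum>f\<in>UNIV. M $ e $ f * (\<Sum>p\<in>?P. of_int (sign p) * (A $ p 0 $ a * A $ p 1 $ b) *
        (A $ p 2 $ c * A $ p 3 $ d) * (A $ p 4 $ e * A $ p 5 $ f) * ?E p 6 7 * 1))))"
    by (simp only: mult_1_right)
  also have "\<dots> = (\<Sum>a\<in>UNIV. \<Sum>b\<in>UNIV. M $ a $ b * (\<Sum>c\<in>UNIV. \<Sum>d\<in>UNIV. M $ c $ d *
      (\<Sum>e\<in>UNIV. \<Sum>f\<in>UNIV. M $ e $ f * (\<Sum>g\<in>UNIV. \<Sum>h\<in>UNIV. M $ g $ h *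
       (\<Sum>p\<in>?P. of_int (sign p) * (A $ p 0 $ a * A $ p 1 $ b) *
        (A $ p 2 $ c * A $ p 3 $ d) * (A $ p 4 $ e * A $ p 5 $ f) * (A $ p 6 $ g * A $ p 7 $ h) * 1)))))"
    unfolding entry[of "_ 6" "_ 7"] by (subst sum_bilinear_swap) (rule refl)
  also have "\<dots> = (\<Sum>a\<in>UNIV. \<Sum>b\<in>UNIV. M $ a $ b * (\<Sum>c\<in>UNIV. \<Sum>d\<in>UNIV. M $ c $ d *
      (\<Sum>e\<in>UNIV. \<Sum>f\<in>UNIV. M $ e $ f * (\<Sum>g\<in>UNIV. \<Sum>h\<in>UNIV. M $ g $ h *
       (det A * eps8 a b c d e f g h)))))"
    unfolding sum_permutes_eq_eps8[symmetric] by (simp only: mult.assoc mult_1_right)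
  also have "\<dots> = det A * ?S"
    by (simp only: sum_distrib_left mult.left_commute[of _ "det A"])
  finally show ?thesis unfolding Pf_def by simp
qed

lemma Pf_eq_eps8:
  "Pf M = 1 / (fact 4 * 2 ^ 4) *
    (\<Sum>a\<in>UNIV. \<Sum>b\<in>UNIV. M $ a $ b * (\<Sum>c\<in>UNIV. \<Sum>d\<in>UNIV. M $ c $ d * (\<Sum>e\<in>UNIV. \<Sum>f\<in>UNIV. M $ e $ f *
     (\<Sum>g\<in>UNIV. \<Sum>h\<in>UNIV. M $ g $ h * eps8 a b c d e f g h))))"
  using Pf_conj_eq_eps8[of "mat 1" M] by simp

lemma Pf_conj: "Pf (A ** M ** transpose A) = det A * Pf M"
  unfolding Pf_eq_eps8[of M] by (rule Pf_conj_eq_eps8)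

section \<open>The summands and the automorphism\<close>

definition block_embed :: "nat \<Rightarrow> complex^4 \<Rightarrow> mat8" where
  "block_embed i x = so8_of (\<lambda>j. if j = i then x else 0)"

lemma block_embed_in_so8: "block_embed i x \<in> so8"
  unfolding block_embed_def by (rule so8_of_in_so8)

lemma so8_sigma_block_embed:
  assumes "i \<in> {1..7}"
  shows "so8_sigma (block_embed i x) = block_embed i (sigma_matrix *v x)"
  unfolding so8_sigma_eq_so8_of block_embed_def
  by (rule so8_of_cong) (auto simp: block_coords_so8_of)

lemma interval_1_7_cases:
  assumes "i \<in> {1..7::nat}"
  obtains "i = 1" | "i = 2" | "i = 3" | "i = 4" | "i = 5" | "i = 6" | "i = 7"
  using assms unfolding atLeastAtMost_1_7 by blast

lemma matrix_mult_8_nth: "((A :: mat8) ** B) $ i $ j = A $ i $ 0 * B $ 0 $ j + A $ i $ 1 * B $ 1 $ j +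
   A $ i $ 2 * B $ 2 $ j + A $ i $ 3 * B $ 3 $ j + A $ i $ 4 * B $ 4 $ j + A $ i $ 5 * B $ 5 $ j +
   A $ i $ 6 * B $ 6 $ j + A $ i $ 7 * B $ 7 $ j"
  by (simp add: matrix_matrix_mult_def sum_8)

text \<open>The four index pairs of a summand partition the eight indices, so up to reordering the
  matrix is a direct sum of skew 2x2 blocks with entries \<plusminus>1.\<close>

lemma block_embed_square:
  assumes "i \<in> {1..7}" "\<And>k. x $ k * x $ k = 1"
  shows "block_embed i x ** block_embed i x = - mat 1"
  using assms(1)
  by (cases i rule: interval_1_7_cases)
    (simp_all add: vec_eq_iff forall_8 matrix_mult_8_nth block_embed_def so8_of_entries mat_def assms(2))

lemma transpose_diff: "transpose (A - B) = transpose A - transpose B"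
  by (simp add: transpose_def vec_eq_iff)

lemma commutator_in_so8: "A \<in> so8 \<Longrightarrow> B \<in> so8 \<Longrightarrow> commutator A B \<in> so8"
  by (simp add: so8_def commutator_def transpose_diff matrix_transpose_mul matrix_minus_left matrix_minus_right)

lemma so8_eqI:
  assumes "A \<in> so8" "B \<in> so8" "\<And>j. j \<in> {1..7} \<Longrightarrow> block_coords A j = block_coords B j"
  shows "A = B"
proof -
  have "so8_of (block_coords A) = so8_of (block_coords B)"
    by (rule so8_of_cong) (rule assms(3))
  then show ?thesis by (simp add: so8_of_block_coords assms)
qed

text \<open>A finite check over the 49 pairs of summands \<open>i\<close>, \<open>j\<close>: each
  coordinate of either side is an explicit bilinear expression in \<open>x\<close> and
  \<open>c\<close>.\<close>

lemma so8_sigma_commutator_block_embed_so8_of: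
  assumes "i \<in> {1..7}"
  shows "so8_sigma (commutator (block_embed i x) (so8_of c))
    = commutator (block_embed i (sigma_matrix *v x)) (so8_of (\<lambda>j. sigma_matrix *v c j))"
proof (rule so8_eqI)
  fix j :: nat assume j: "j \<in> {1..7}"
  have "\<forall>k. (sigma_matrix *v block_coords (commutator (block_embed i x) (so8_of c)) j) $ k
      = block_coords (commutator (block_embed i (sigma_matrix *v x)) (so8_of (\<lambda>j. sigma_matrix *v c j))) j $ k"
    by (rule interval_1_7_cases[OF j]; rule interval_1_7_cases[OF assms];
        simp only: forall_4 matrix_vector_mult_def sum_4 vec_lambda_beta block_coords_nth
          commutator_def vector_minus_component matrix_mult_8_nth block_embed_def;
        simp add: ix_simps so8_of_entries sigma_matrix_entries; simp add: field_simps)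
  then show "block_coords (so8_sigma (commutator (block_embed i x) (so8_of c))) j
      = block_coords (commutator (block_embed i (sigma_matrix *v x)) (so8_of (\<lambda>j. sigma_matrix *v c j))) j"
    using j by (simp add: block_coords_so8_sigma vec_eq_iff)
qed (intro so8_sigma_in_so8 commutator_in_so8 block_embed_in_so8 so8_of_in_so8)+

lemma so8_sigma_commutator_block_embed:
  assumes "i \<in> {1..7}" "N \<in> so8"
  shows "so8_sigma (commutator (block_embed i x) N)
    = commutator (block_embed i (sigma_matrix *v x)) (so8_sigma N)"
  using so8_sigma_commutator_block_embed_so8_of[OF assms(1), of x "block_coords N"]
  by (simp add: so8_of_block_coords assms(2) so8_sigma_eq_so8_of[of N])

text \<open>The summands are orthogonal for the trace form, so vanishing traces become linear
  equations for the coordinates in one summand.\<close>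

lemma trace_block_embed_mult:
  assumes "i \<in> {1..7}" "Z \<in> so8"
  shows "trace (block_embed i x ** Z) = - 2 * (\<Sum>k\<in>UNIV. x $ k * block_coords Z i $ k)"
proof -
  define c where "c = block_coords Z"
  have Z: "Z = so8_of c" by (simp add: c_def so8_of_block_coords assms)
  show ?thesis unfolding Z block_coords_so8_of[OF assms(1)] using assms(1)
  by (cases i rule: interval_1_7_cases)
    (simp_all add: trace_def sum_8 sum_4 matrix_mult_8_nth block_embed_def so8_of_entries)
qed

section \<open>One-parameter groups of rotations\<close>

text \<open>The exponential of \<open>t\<close> times \<open>X\<close> in closed form, when
  \<open>X ** X = - mat 1\<close>.\<close>

definition rot :: "mat8 \<Rightarrow> real \<Rightarrow> mat8" where
  "rot X t = cos t *\<^sub>R mat 1 + sin t *\<^sub>R X"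

lemma rot_0: "rot X 0 = mat 1"
  by (simp add: rot_def)

lemma rot_mult:
  assumes "X ** X = - mat 1"
  shows "rot X s ** rot X t = rot X (s + t)"
  by (simp add: rot_def matrix_ring_simps assms cos_add sin_add algebra_simps)

lemma transpose_rot:
  assumes "X \<in> so8"
  shows "transpose (rot X t) = rot X (- t)"
proof -
  have "transpose (rot X t) = cos t *\<^sub>R transpose (mat 1) + sin t *\<^sub>R transpose X"
    unfolding rot_def by (vector transpose_def)
  also have "transpose X = - X" using assms by (simp add: so8_def)
  finally show ?thesis by (simp add: rot_def)
qed

text \<open>Orthogonality alone leaves the sign open; it is settled by \<open>rot X t\<close> being
  the square of the orthogonal matrix \<open>rot X (t/2)\<close>.\<close>

lemma det_rot:
  assumes "X \<in> so8" "X ** X = - mat 1"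
  shows "det (rot X t) = 1"
proof -
  have "det (rot X (t/2) ** transpose (rot X (t/2))) = 1"
    by (simp add: transpose_rot rot_mult assms rot_0)
  then have "det (rot X (t/2)) * det (rot X (t/2)) = 1" by (simp only: det_mul det_transpose)
  then have "det (rot X (t/2) ** rot X (t/2)) = 1" by (simp only: det_mul)
  then show ?thesis by (simp add: rot_mult assms)
qed

text \<open>Conjugation is the exponential of \<open>t\<close> times ad \<open>X\<close>, and
  \<open>X ** X = - mat 1\<close> makes the cube of ad \<open>X\<close> equal to -4 ad
  \<open>X\<close>, so two brackets suffice. A linear map respecting brackets with \<open>X\<close>
  can be applied term by term to the right side.\<close>

lemma rot_conj_eq:
  assumes "X ** X = - mat 1"
  shows "rot X t ** N ** rot X (- t) = N + (cos t * sin t) *\<^sub>R commutator X N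
     + ((sin t)\<^sup>2 / 2) *\<^sub>R commutator X (commutator X N)"
proof -
  have XX: "X ** (X ** B) = - B" for B
    by (simp add: matrix_mul_assoc assms matrix_minus_left)
  have 1: "commutator X (commutator X N) = (-2) *\<^sub>R (N + X ** N ** X)"
    by (simp add: commutator_def matrix_ring_simps XX assms algebra_simps flip: matrix_mul_assoc)
      (simp add: scaleR_2)
  have 2: "rot X t ** N ** rot X (- t) = (cos t)\<^sup>2 *\<^sub>R N + (cos t * sin t) *\<^sub>R commutator X N - (sin t)\<^sup>2 *\<^sub>R (X ** N ** X)"
    by (simp add: rot_def commutator_def matrix_ring_simps algebra_simps power2_eq_square)
  show ?thesis unfolding 2 1 cos_squared_eq by (simp add: algebra_simps)
qed

section \<open>Real and complex linearity of the automorphism\<close>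

lemma block_coords_add: "block_coords (A + B) i = block_coords A i + block_coords B i"
  by (simp add: vec_eq_iff forall_4 block_coords_nth)

lemma block_coords_cmul: "block_coords (cmul z A) i = z *s block_coords A i"
  by (simp add: vec_eq_iff forall_4 block_coords_nth cmul_def)

lemma so8_of_add: "so8_of (\<lambda>i. c i + d i) = so8_of c + so8_of d"
  by (simp add: vec_eq_iff so8_of_nth_expanded algebra_simps)

lemma so8_of_cmul: "so8_of (\<lambda>i. z *s c i) = cmul z (so8_of c)"
  by (simp add: vec_eq_iff so8_of_nth_expanded cmul_def algebra_simps)

lemma so8_sigma_add: "so8_sigma (A + B) = so8_sigma A + so8_sigma B"
  by (simp add: so8_sigma_eq_so8_of block_coords_add matrix_vector_right_distrib so8_of_add)

lemma so8_sigma_cmul: "so8_sigma (cmul z A) = cmul z (so8_sigma A)"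
  by (simp add: so8_sigma_eq_so8_of block_coords_cmul vector_scalar_commute so8_of_cmul)

lemma cmul_of_real: "cmul (of_real r) A = r *\<^sub>R A"
  by (simp add: vec_eq_iff cmul_def scaleR_conv_of_real[of _ "_ :: complex"])

lemma so8_sigma_scaleR: "so8_sigma (r *\<^sub>R A) = r *\<^sub>R so8_sigma A"
  using so8_sigma_cmul[of "of_real r" A] by (simp add: cmul_of_real)

text \<open>By \<open>y\<close> the image of \<open>block_embed i x\<close> also has square
  \<open>- mat 1\<close>, so \<open>rot_conj_eq\<close> applies on both sides and
  \<open>so8_sigma\<close> passes through its brackets.\<close>

lemma so8_sigma_rot_conj:
  assumes i: "i \<in> {1..7}" and x: "\<And>k. x $ k * x $ k = 1"
    and y: "\<And>k. (sigma_matrix *v x) $ k * (sigma_matrix *v x) $ k = 1" and N: "N \<in> so8"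
  shows "so8_sigma (rot (block_embed i x) t ** N ** rot (block_embed i x) (- t))
    = rot (block_embed i (sigma_matrix *v x)) t ** so8_sigma N ** rot (block_embed i (sigma_matrix *v x)) (- t)"
  by (simp only: rot_conj_eq[OF block_embed_square[OF i x]] rot_conj_eq[OF block_embed_square[OF i y]]
      so8_sigma_add so8_sigma_scaleR so8_sigma_commutator_block_embed[OF i]
      N commutator_in_so8 block_embed_in_so8)

section \<open>Real matrices with given invariants\<close>

definition real_mat :: "complex^'n^'m \<Rightarrow> bool" where
  "real_mat A \<longleftrightarrow> (\<forall>i j. A $ i $ j \<in> \<real>)"

lemma real_mat_mult: "real_mat A \<Longrightarrow> real_mat B \<Longrightarrow> real_mat (A ** B)"
  by (auto simp: real_mat_def matrix_matrix_mult_def intro!: sum_in_Reals Reals_mult)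

lemma real_mat_diff: "real_mat A \<Longrightarrow> real_mat B \<Longrightarrow> real_mat (A - B)"
  by (auto simp: real_mat_def)

lemma real_mat_rot: "real_mat X \<Longrightarrow> real_mat (rot X t)"
  by (auto simp: real_mat_def rot_def mat_def scaleR_conv_of_real[of _ "_ :: complex"])

lemma real_mat_trace: "real_mat A \<Longrightarrow> trace A \<in> \<real>"
  by (auto simp: real_mat_def trace_def intro!: sum_in_Reals)

lemma real_mat_block_embed:
  assumes "\<And>k. x $ k \<in> \<real>"
  shows "real_mat (block_embed i x)"
  unfolding real_mat_def forall_8 block_embed_def so8_of_entries
  using assms by (simp add: Reals_minus_iff)

text \<open>The invariants of \<open>so8_sigma N\<close> are included so that relations between both
  sets of invariants carry over to \<open>M\<close> from any member.\<close>

definition isospectral :: "mat8 \<Rightarrow> mat8 set" where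
  "isospectral M = {N. N \<in> so8 \<and> real_mat N \<and>
     (\<forall>k. trace (mat_power N k) = trace (mat_power M k)) \<and> Pf N = Pf M \<and>
     (\<forall>k. trace (mat_power (so8_sigma N) k) = trace (mat_power (so8_sigma M) k)) \<and>
     Pf (so8_sigma N) = Pf (so8_sigma M)}"

lemma conj_in_so8: "N \<in> so8 \<Longrightarrow> A ** N ** transpose A \<in> so8"
  by (simp add: so8_def matrix_transpose_mul matrix_minus_left matrix_minus_right matrix_mul_assoc)

text \<open>One rotation conjugates \<open>N\<close> and, by \<open>so8_sigma_rot_conj\<close>,
  another conjugates \<open>so8_sigma N\<close>; both are orthogonal of determinant 1, so no trace
  and no Pfaffian changes.\<close>

lemma rot_conj_isospectral:
  assumes i: "i \<in> {1..7}" and x: "\<And>k. x $ k * x $ k = 1" "\<And>k. x $ k \<in> \<real>"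
    and y: "\<And>k. (sigma_matrix *v x) $ k * (sigma_matrix *v x) $ k = 1" and N: "N \<in> isospectral M"
  shows "rot (block_embed i x) t ** N ** rot (block_embed i x) (- t) \<in> isospectral M"
proof -
  have inv: "rot X t ** N ** rot X (- t) \<in> so8"
    "trace (mat_power (rot X t ** N ** rot X (- t)) k) = trace (mat_power N k)"
    "Pf (rot X t ** N ** rot X (- t)) = Pf N"
    if "X \<in> so8" "X ** X = - mat 1" "N \<in> so8" for X N k
    using conj_in_so8[OF that(3), of "rot X t"] Pf_conj[of "rot X t" N] det_rot[OF that(1,2)]
    by (simp_all add: transpose_rot that trace_mat_power_conj rot_mult rot_0)
  let ?X = "block_embed i x" and ?Y = "block_embed i (sigma_matrix *v x)"
  have N': "N \<in> so8" "real_mat N" using N by (simp_all add: isospectral_def)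
  have X: "?X \<in> so8" "?X ** ?X = - mat 1" "real_mat ?X"
    using block_embed_in_so8 block_embed_square[OF i x(1)] real_mat_block_embed[OF x(2)] by blast+
  have Y: "?Y \<in> so8" "?Y ** ?Y = - mat 1"
    using block_embed_in_so8 block_embed_square[OF i y] by blast+
  show ?thesis
    using N so8_sigma_rot_conj[OF i x(1) y N'(1)]
    by (simp add: isospectral_def inv[OF X(1,2) N'(1)] inv[OF Y so8_sigma_in_so8]
        real_mat_mult real_mat_rot X N')
qed

section \<open>Continuity of the invariants and compactness of their level sets\<close>

lemma continuous_on_mat_mult [continuous_intros]:
  fixes A :: "'b::topological_space \<Rightarrow> complex^'n^'m"
  assumes "continuous_on S A" "continuous_on S B"
  shows "continuous_on S (\<lambda>x. A x ** B x)"
  unfolding matrix_matrix_mult_def by (intro continuous_intros assms)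

lemma continuous_on_mat_power [continuous_intros]:
  assumes "continuous_on S F"
  shows "continuous_on S (\<lambda>x. mat_power (F x) k)"
  by (induction k) (auto simp: mat_power_0 mat_power_Suc intro!: continuous_intros assms)

lemma continuous_on_trace [continuous_intros]:
  fixes F :: "'b::topological_space \<Rightarrow> complex^'n^'n"
  assumes "continuous_on S F"
  shows "continuous_on S (\<lambda>x. trace (F x))"
  unfolding trace_def by (intro continuous_intros assms)

lemma continuous_on_Pf [continuous_intros]:
  assumes "continuous_on S F"
  shows "continuous_on S (\<lambda>x. Pf (F x))"
  unfolding Pf_def by (intro continuous_intros assms)

lemma linear_so8_sigma: "linear so8_sigma"
  by (intro linearI so8_sigma_add so8_sigma_scaleR)

lemma continuous_on_so8_sigma [continuous_intros]:
  assumes "continuous_on S F"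
  shows "continuous_on S (\<lambda>x. so8_sigma (F x))"
  using linear_so8_sigma assms by (simp add: linear_conv_bounded_linear bounded_linear.continuous_on)

lemma mat_power_2: "mat_power M 2 = M ** M"
  by (simp add: mat_power_def numeral_2_eq_2)

text \<open>All defining conditions are closed, and for real skew-symmetric \<open>N\<close> the
  number \<open>- trace (mat_power N 2)\<close> is the squared Euclidean norm, so fixing this trace
  gives a bound.\<close>

lemma compact_isospectral: "compact (isospectral M)"
proof -
  have "closed {N :: mat8. N $ j $ i = - N $ i $ j}" "closed {N :: mat8. Im (N $ i $ j) = 0}" for i j
    by (intro closed_Collect_eq continuous_intros)+
  moreover have "closed {N. trace (mat_power N k) = c}" "closed {N. trace (mat_power (so8_sigma N) k) = c}"
    "closed {N. Pf N = c}" "closed {N. Pf (so8_sigma N) = c}" for c k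
    by (intro closed_Collect_eq continuous_intros)+
  ultimately have "closed (isospectral M)"
    unfolding isospectral_def so8_iff real_mat_def complex_is_Real_iff
    by (intro closed_Collect_conj closed_Collect_all)
  moreover have "norm N \<le> sqrt (- Re (trace (mat_power M 2)))" if N: "N \<in> isospectral M" for N
  proof -
    have "N \<in> so8" "real_mat N" using N by (simp_all add: isospectral_def)
    then have s: "N $ j $ i = - N $ i $ j" and r: "Im (N $ i $ j) = 0" for i j
      unfolding so8_iff real_mat_def complex_is_Real_iff by blast+
    have "- Re (trace (mat_power N 2)) = (\<Sum>i\<in>UNIV. \<Sum>j\<in>UNIV. - Re (N $ i $ j * N $ j $ i))"
      by (simp add: mat_power_2 trace_def matrix_matrix_mult_def sum_negf del: minus_complex.sel times_complex.sel)
    also have "\<dots> = (\<Sum>i\<in>UNIV. \<Sum>j\<in>UNIV. (norm (N $ i $ j))\<^sup>2)"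
    proof (intro sum.cong refl)
      fix i j
      show "- Re (N $ i $ j * N $ j $ i) = (norm (N $ i $ j))\<^sup>2"
        unfolding s[of i j] by (simp add: cmod_power2 r flip: power2_eq_square)
    qed
    also have "\<dots> = (norm N)\<^sup>2"
      by (simp only: norm_vec_def L2_set_def real_sqrt_pow2 sum_nonneg zero_le_power2)
    finally have "norm N = sqrt (- Re (trace (mat_power N 2)))"
      by (simp only: real_sqrt_abs abs_norm_cancel)
    also have "trace (mat_power N 2) = trace (mat_power M 2)"
      using N by (simp add: isospectral_def)
    finally show ?thesis by simp
  qed
  ultimately show ?thesis by (auto simp: compact_eq_bounded_closed bounded_iff)
qed

section \<open>The Pfaffian on the first summand\<close>

lemma eps8_swap:
  shows "eps8 b a c d e f g h = - eps8 a b c d e f g h"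
    and "eps8 a c b d e f g h = - eps8 a b c d e f g h"
    and "eps8 a b d c e f g h = - eps8 a b c d e f g h"
    and "eps8 a b c e d f g h = - eps8 a b c d e f g h"
    and "eps8 a b c d f e g h = - eps8 a b c d e f g h"
    and "eps8 a b c d e g f h = - eps8 a b c d e f g h"
    and "eps8 a b c d e f h g = - eps8 a b c d e f g h"
proof -
  have swap: "eps8 a' b' c' d' e' f' g' h' = - eps8 a b c d e f g h"
    if "i \<noteq> j" "fun8 a' b' c' d' e' f' g' h' = fun8 a b c d e f g h \<circ> Transposition.transpose i j"
    for a b c d e f g h a' b' c' d' e' f' g' h' i j
    unfolding eps8_def that(2) by (rule levi_civita_swap[OF that(1)])
  show "eps8 b a c d e f g h = - eps8 a b c d e f g h"
    by (rule swap[of 0 1]) (simp_all add: fun_eq_iff forall_8 fun8_simps Transposition.transpose_def)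
  show "eps8 a c b d e f g h = - eps8 a b c d e f g h"
    by (rule swap[of 1 2]) (simp_all add: fun_eq_iff forall_8 fun8_simps Transposition.transpose_def)
  show "eps8 a b d c e f g h = - eps8 a b c d e f g h"
    by (rule swap[of 2 3]) (simp_all add: fun_eq_iff forall_8 fun8_simps Transposition.transpose_def)
  show "eps8 a b c e d f g h = - eps8 a b c d e f g h"
    by (rule swap[of 3 4]) (simp_all add: fun_eq_iff forall_8 fun8_simps Transposition.transpose_def)
  show "eps8 a b c d f e g h = - eps8 a b c d e f g h"
    by (rule swap[of 4 5]) (simp_all add: fun_eq_iff forall_8 fun8_simps Transposition.transpose_def)
  show "eps8 a b c d e g f h = - eps8 a b c d e f g h"
    by (rule swap[of 5 6]) (simp_all add: fun_eq_iff forall_8 fun8_simps Transposition.transpose_def)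
  show "eps8 a b c d e f h g = - eps8 a b c d e f g h"
    by (rule swap[of 6 7]) (simp_all add: fun_eq_iff forall_8 fun8_simps Transposition.transpose_def)
qed

text \<open>On the first summand every term of the Pfaffian selects four of its index pairs; these
  rules remove the terms that select a pair twice.\<close>

lemma eps8_repeat:
  shows "eps8 a b a b e f g h = 0"
    and "eps8 a b c d a b g h = 0"
    and "eps8 a b c d e f a b = 0"
    and "eps8 a b c d c d g h = 0"
    and "eps8 a b c d e f c d = 0"
    and "eps8 a b c d e f e f = 0"
proof -
  show "eps8 a b a b e f g h = 0"
    unfolding eps8_def by (rule levi_civita_not_inj[of 0 2]) (simp_all add: fun8_simps)
  show "eps8 a b c d a b g h = 0"
    unfolding eps8_def by (rule levi_civita_not_inj[of 0 4]) (simp_all add: fun8_simps)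
  show "eps8 a b c d e f a b = 0"
    unfolding eps8_def by (rule levi_civita_not_inj[of 0 6]) (simp_all add: fun8_simps)
  show "eps8 a b c d c d g h = 0"
    unfolding eps8_def by (rule levi_civita_not_inj[of 2 4]) (simp_all add: fun8_simps)
  show "eps8 a b c d e f c d = 0"
    unfolding eps8_def by (rule levi_civita_not_inj[of 2 6]) (simp_all add: fun8_simps)
  show "eps8 a b c d e f e f = 0"
    unfolding eps8_def by (rule levi_civita_not_inj[of 4 6]) (simp_all add: fun8_simps)
qed

text \<open>Exchanging two neighbouring pairs takes four adjacent transpositions, an even
  permutation.\<close>

lemma eps8_swap_pairs:
  shows "eps8 c d a b e f g h = eps8 a b c d e f g h"
    and "eps8 a b e f c d g h = eps8 a b c d e f g h"
    and "eps8 a b c d g h e f = eps8 a b c d e f g h"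
proof -
  have "eps8 c d a b e f g h = - eps8 c a d b e f g h"
    by (simp only: eps8_swap(2)[of c d a b e f g h] minus_minus)
  also have "\<dots> = eps8 a c d b e f g h"
    by (simp only: eps8_swap(1)[of c a d b e f g h] minus_minus)
  also have "\<dots> = - eps8 a c b d e f g h"
    by (simp only: eps8_swap(3)[of a c d b e f g h] minus_minus)
  also have "\<dots> = eps8 a b c d e f g h"
    by (simp only: eps8_swap(2)[of a c b d e f g h] minus_minus)
  finally show "eps8 c d a b e f g h = eps8 a b c d e f g h" .
  have "eps8 a b e f c d g h = - eps8 a b e c f d g h"
    by (simp only: eps8_swap(4)[of a b e f c d g h] minus_minus)
  also have "\<dots> = eps8 a b c e f d g h"
    by (simp only: eps8_swap(3)[of a b e c f d g h] minus_minus)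
  also have "\<dots> = - eps8 a b c e d f g h"
    by (simp only: eps8_swap(5)[of a b c e f d g h] minus_minus)
  also have "\<dots> = eps8 a b c d e f g h"
    by (simp only: eps8_swap(4)[of a b c e d f g h] minus_minus)
  finally show "eps8 a b e f c d g h = eps8 a b c d e f g h" .
  have "eps8 a b c d g h e f = - eps8 a b c d g e h f"
    by (simp only: eps8_swap(6)[of a b c d g h e f] minus_minus)
  also have "\<dots> = eps8 a b c d e g h f"
    by (simp only: eps8_swap(5)[of a b c d g e h f] minus_minus)
  also have "\<dots> = - eps8 a b c d e g f h"
    by (simp only: eps8_swap(7)[of a b c d e g h f] minus_minus)
  also have "\<dots> = eps8 a b c d e f g h"
    by (simp only: eps8_swap(6)[of a b c d e g f h] minus_minus)
  finally show "eps8 a b c d g h e f = eps8 a b c d e f g h" .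
qed

lemma eps8_id: "eps8 0 1 2 3 4 5 6 7 = 1"
proof -
  have "fun8 0 1 2 3 4 5 6 7 = (\<lambda>i. i)"
    by (simp add: fun_eq_iff forall_8 fun8_simps)
  then have "eps8 0 1 2 3 4 5 6 7 = det ((\<chi> i j. if j = i then 1 else 0) :: mat8)"
    by (simp add: eps8_def levi_civita_def)
  also have "(\<chi> i j. if j = i then 1 else 0) = (mat 1 :: mat8)"
    by (simp add: mat_def vec_eq_iff)
  finally show ?thesis by simp
qed

text \<open>Listing the index pairs of the first summand in order gives an odd permutation; this is
  the source of the sign in \<open>Pf_block_embed_1\<close>.\<close>

lemma eps8_block_1: "eps8 0 1 2 4 3 7 5 6 = - 1"
proof -
  have "eps8 0 1 2 4 3 7 5 6 = - eps8 0 1 2 3 4 7 5 6" by (rule eps8_swap(4))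
  also have "\<dots> = eps8 0 1 2 3 4 5 7 6" using eps8_swap(6)[of 0 1 2 3 4 7 5 6] by simp
  also have "\<dots> = - eps8 0 1 2 3 4 5 6 7" by (rule eps8_swap(7))
  finally show ?thesis by (simp add: eps8_id)
qed

text \<open>As rewrite rules these sort the pairs \<open>(0, 1)\<close>, \<open>(2, 4)\<close>, \<open>(3, 7)\<close>, \<open>(5, 6)\<close> of the first summand into this order.\<close>

lemmas eps8_sort =
  eps8_swap_pairs(1)[of 2 4 0 1 _ _ _ _]
  eps8_swap_pairs(1)[of 3 7 0 1 _ _ _ _]
  eps8_swap_pairs(1)[of 3 7 2 4 _ _ _ _]
  eps8_swap_pairs(1)[of 5 6 0 1 _ _ _ _]
  eps8_swap_pairs(1)[of 5 6 2 4 _ _ _ _]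
  eps8_swap_pairs(1)[of 5 6 3 7 _ _ _ _]
  eps8_swap_pairs(2)[of _ _ 2 4 0 1 _ _]
  eps8_swap_pairs(2)[of _ _ 3 7 0 1 _ _]
  eps8_swap_pairs(2)[of _ _ 3 7 2 4 _ _]
  eps8_swap_pairs(2)[of _ _ 5 6 0 1 _ _]
  eps8_swap_pairs(2)[of _ _ 5 6 2 4 _ _]
  eps8_swap_pairs(2)[of _ _ 5 6 3 7 _ _]
  eps8_swap_pairs(3)[of _ _ _ _ 2 4 0 1]
  eps8_swap_pairs(3)[of _ _ _ _ 3 7 0 1]
  eps8_swap_pairs(3)[of _ _ _ _ 3 7 2 4]
  eps8_swap_pairs(3)[of _ _ _ _ 5 6 0 1]
  eps8_swap_pairs(3)[of _ _ _ _ 5 6 2 4]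
  eps8_swap_pairs(3)[of _ _ _ _ 5 6 3 7]

text \<open>Half the contraction of \<open>block_embed 1 y\<close> with an antisymmetric
  \<open>g\<close>: one term for each index pair of the first summand.\<close>

definition pairing_sum :: "complex^4 \<Rightarrow> (8 \<Rightarrow> 8 \<Rightarrow> complex) \<Rightarrow> complex" where
  "pairing_sum y g = y $ 1 * g 0 1 + y $ 2 * g 2 4 + y $ 3 * g 3 7 + y $ 4 * g 5 6"

lemma pairing_sum_minus: "pairing_sum y (\<lambda>a b. - g a b) = - pairing_sum y g"
  by (simp add: pairing_sum_def)

lemma sum_block_embed_1_antisym:
  assumes "\<And>a b. g b a = - g a b"
  shows "(\<Sum>a\<in>UNIV. \<Sum>b\<in>UNIV. block_embed 1 y $ a $ b * g a b) = 2 * pairing_sum y g"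
  using assms[of 1 0] assms[of 4 2] assms[of 7 3] assms[of 6 5]
  by (simp add: sum_8 block_embed_def so8_of_entries pairing_sum_def)

text \<open>Four contractions give the factor \<open>2 ^ 4\<close>, and the 4! orderings of the four
  distinct pairs survive with equal sign. Their product 384 cancels the normalisation.\<close>

lemma Pf_block_embed_1: "Pf (block_embed 1 y) = - (y $ 1 * y $ 2 * y $ 3 * y $ 4)"
proof -
  let ?N = "block_embed 1 y" and ?P = "pairing_sum y"
  have 1: "(\<Sum>g\<in>UNIV. \<Sum>h\<in>UNIV. ?N $ g $ h * eps8 a b c d e f g h) = 2 * ?P (\<lambda>g h. eps8 a b c d e f g h)"
    for a b c d e f by (rule sum_block_embed_1_antisym) (rule eps8_swap)
  have 2: "(\<Sum>e\<in>UNIV. \<Sum>f\<in>UNIV. ?N $ e $ f * (2 * ?P (\<lambda>g h. eps8 a b c d e f g h)))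
    = 2 * ?P (\<lambda>e f. 2 * ?P (\<lambda>g h. eps8 a b c d e f g h))" for a b c d
    by (rule sum_block_embed_1_antisym)
      (subst eps8_swap(5), simp only: pairing_sum_minus mult_minus_right)
  have 3: "(\<Sum>c\<in>UNIV. \<Sum>d\<in>UNIV. ?N $ c $ d * (2 * ?P (\<lambda>e f. 2 * ?P (\<lambda>g h. eps8 a b c d e f g h))))
    = 2 * ?P (\<lambda>c d. 2 * ?P (\<lambda>e f. 2 * ?P (\<lambda>g h. eps8 a b c d e f g h)))" for a b
    by (rule sum_block_embed_1_antisym)
      (subst eps8_swap(3), simp only: pairing_sum_minus mult_minus_right)
  have 4: "(\<Sum>a\<in>UNIV. \<Sum>b\<in>UNIV. ?N $ a $ b * (2 * ?P (\<lambda>c d. 2 * ?P (\<lambda>e f. 2 * ?P (\<lambda>g h. eps8 a b c d e f g h)))))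
    = 2 * ?P (\<lambda>a b. 2 * ?P (\<lambda>c d. 2 * ?P (\<lambda>e f. 2 * ?P (\<lambda>g h. eps8 a b c d e f g h))))"
    by (rule sum_block_embed_1_antisym)
      (subst eps8_swap(1), simp only: pairing_sum_minus mult_minus_right)
  have "2 * ?P (\<lambda>a b. 2 * ?P (\<lambda>c d. 2 * ?P (\<lambda>e f. 2 * ?P (\<lambda>g h. eps8 a b c d e f g h))))
    = - (384 * (y $ 1 * y $ 2 * y $ 3 * y $ 4))"
    by (simp add: pairing_sum_def eps8_repeat eps8_sort eps8_block_1)
  then show ?thesis unfolding Pf_eq_eps8 1 2 3 4 by (simp add: fact_numeral)
qed

section \<open>Maximising a linear functional\<close>

text \<open>The left side vanishes at \<open>t = 0\<close>, hence is maximal there, and its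
  derivative at that point is \<open>a\<close>.\<close>

lemma coeff_eq_0_of_rot_le_0:
  assumes "\<And>t. cos t * sin t * a + (sin t)\<^sup>2 / 2 * b \<le> (0 :: real)"
  shows "a = 0"
proof -
  have "((\<lambda>t. cos t * sin t * a + (sin t)\<^sup>2 / 2 * b) has_real_derivative a) (at 0)"
    by (auto intro!: derivative_eq_intros)
  then show ?thesis
    by (rule DERIV_local_max[of _ _ _ 1]) (use assms in auto)
qed

text \<open>Since \<open>1, 2, 3, 4\<close> have distinct squares, commuting with this element forces a matrix into the
  first summand, a Cartan subalgebra.\<close>

definition regular_element :: mat8 where
  "regular_element = block_embed 1 (vector [1, 2, 3, 4])"

text \<open>Invariance of the trace form. It isolates \<open>X\<close>, so that conditions for many
  \<open>X\<close> all test the single matrix \<open>commutator N H\<close>.\<close>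

lemma trace_commutator_swap:
  fixes H :: "'a::comm_ring_1^'n^'n"
  shows "trace (H ** commutator X N) = trace (X ** commutator N H)"
proof -
  have "trace (H ** (X ** N)) = trace (X ** (N ** H))"
    using trace_mul_sym[of H "X ** N"] by (simp add: matrix_mul_assoc)
  moreover have "trace (H ** (N ** X)) = trace (X ** (H ** N))"
    using trace_mul_sym[of "H ** N" X] by (simp add: matrix_mul_assoc)
  ultimately show ?thesis by (simp add: commutator_def matrix_diff_ldistrib trace_sub)
qed

lemma real_mat_regular_element: "real_mat regular_element"
  unfolding regular_element_def
proof (rule real_mat_block_embed)
  have "\<forall>k. (vector [1, 2, 3, 4] :: complex^4) $ k \<in> \<real>"
    by (simp add: forall_4 vector_4)
  then show "(vector [1, 2, 3, 4] :: complex^4) $ k \<in> \<real>" for k by blast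
qed

lemma Re_trace_mult_add_scaleR:
  "Re (trace (H ** (A + r *\<^sub>R B + s *\<^sub>R C))) = Re (trace (H ** (A :: mat8))) + r * Re (trace (H ** B)) + s * Re (trace (H ** C))"
proof -
  have sc: "trace (r *\<^sub>R B) = r *\<^sub>R trace (B :: mat8)" for r B
    by (simp add: trace_def scaleR_sum_right)
  show ?thesis
    by (simp add: matrix_add_ldistrib scaleR_matrix_right trace_add sc)
qed

text \<open>The first-order conditions at the maximum make the commutator orthogonal, for the trace
  form, to a set spanning so(8), where this form is nondegenerate.\<close>

lemma commutator_regular_element_eq_0:
  assumes N: "N \<in> isospectral M"
    and max: "\<And>N'. N' \<in> isospectral M \<Longrightarrow> Re (trace (regular_element ** N')) \<le> Re (trace (regular_element ** N))"
  shows "commutator N regular_element = 0"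
proof -
  let ?H = regular_element
  have N': "N \<in> so8" "real_mat N" using N by (simp_all add: isospectral_def)
  have Z: "commutator N ?H \<in> so8"
    using N' by (simp add: commutator_in_so8 regular_element_def block_embed_in_so8)
  have orth: "(\<Sum>k\<in>UNIV. x $ k * block_coords (commutator N ?H) i $ k) = 0"
    if i: "i \<in> {1..7}" and x: "\<And>k. x $ k * x $ k = 1" "\<And>k. x $ k \<in> \<real>"
      and y: "\<And>k. (sigma_matrix *v x) $ k * (sigma_matrix *v x) $ k = 1" for i x
  proof -
    let ?X = "block_embed i x"
    have "Re (trace (?H ** commutator ?X N)) = 0"
    proof (rule coeff_eq_0_of_rot_le_0)
      fix t
      have "Re (trace (?H ** (rot ?X t ** N ** rot ?X (- t)))) \<le> Re (trace (?H ** N))"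
        by (intro max rot_conj_isospectral i x y N)
      then show "cos t * sin t * Re (trace (?H ** commutator ?X N)) +
          (sin t)\<^sup>2 / 2 * Re (trace (?H ** commutator ?X (commutator ?X N))) \<le> 0"
        unfolding rot_conj_eq[OF block_embed_square[OF i x(1)]] Re_trace_mult_add_scaleR by simp
    qed
    \<comment> \<open>The derivative controls only the real part; the trace itself is real because
      all matrices involved are.\<close>
    moreover have "trace (?H ** commutator ?X N) \<in> \<real>"
      unfolding commutator_def
      by (intro real_mat_trace real_mat_mult real_mat_diff real_mat_regular_element real_mat_block_embed x N')
    ultimately have "trace (?H ** commutator ?X N) = 0"
      by (auto simp: complex_is_Real_iff complex_eq_iff)
    then show ?thesis
      using trace_block_embed_mult[OF i Z, of x] by (simp add: trace_commutator_swap[of ?H ?X N])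
  qed
  show ?thesis
  proof (rule so8_eqI[OF Z])
    show "0 \<in> so8" by (simp add: so8_iff)
    fix i :: nat assume i: "i \<in> {1..7}"
    define z where "z = block_coords (commutator N ?H) i"
    \<comment> \<open>These sign vectors are the columns of \<^term>\<open>2 *\<^sub>R sigma_matrix\<close>; \<^const>\<open>sigma_matrix\<close> sends
      each of them to a sign vector again, so \<open>orth\<close> applies to all four.\<close>
    have o: "a * z $ 1 + b * z $ 2 + c * z $ 3 + d * z $ 4 = 0"
      if "(a, b, c, d) \<in> {(-1, 1, 1, 1), (-1, 1, -1, -1), (-1, -1, 1, -1), (-1, -1, -1, 1)}" for a b c d
    proof -
      let ?x = "vector [a, b, c, d] :: complex^4"
      have "\<forall>k. ?x $ k * ?x $ k = 1" "\<forall>k. ?x $ k \<in> \<real>"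
        "\<forall>k. (sigma_matrix *v ?x) $ k * (sigma_matrix *v ?x) $ k = 1"
        using that by (auto simp: forall_4 vector_4 matrix_vector_mult_def sum_4 sigma_matrix_entries)
      then show ?thesis using orth[OF i, of ?x] by (simp add: z_def sum_4 vector_4)
    qed
    \<comment> \<open>The four sign vectors are linearly independent.\<close>
    have "z $ 1 = 0 \<and> z $ 2 = 0 \<and> z $ 3 = 0 \<and> z $ 4 = 0"
      using o[of "-1" 1 1 1] o[of "-1" 1 "-1" "-1"] o[of "-1" "-1" 1 "-1"] o[of "-1" "-1" "-1" 1]
      by (simp add: complex_eq_iff)
    then show "block_coords (commutator N ?H) i = block_coords 0 i"
      by (simp add: vec_eq_iff forall_4 z_def block_coords_nth)
  qed
qed

text \<open>The square of \<open>regular_element\<close> is diagonal, and two of its diagonal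
  entries agree exactly when their indices are equal or form a pair of the first summand. Commuting
  with it kills all other entries.\<close>

lemma regular_element_centralizer:
  assumes "N \<in> so8" "commutator N regular_element = 0"
  shows "N = block_embed 1 (block_coords N 1)"
proof -
  let ?H = regular_element
  have "N ** ?H = ?H ** N" using assms(2) by (simp add: commutator_def)
  then have comm: "N ** (?H ** ?H) = ?H ** ?H ** N" by (metis matrix_mul_assoc)
  define q :: "8 \<Rightarrow> complex" where "q r = (?H ** ?H) $ r $ r" for r
  have diag: "?H ** ?H = (\<chi> r s. if r = s then q r else 0)"
    by (simp add: vec_eq_iff forall_8 q_def matrix_mult_8_nth regular_element_def block_embed_def so8_of_entries vector_4)
  have q: "q 0 = -1" "q 1 = -1" "q 2 = -4" "q 3 = -9" "q 4 = -4" "q 5 = -16" "q 6 = -16" "q 7 = -9"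
    by (simp_all add: q_def matrix_mult_8_nth regular_element_def block_embed_def so8_of_entries vector_4)
  have *: "N $ r $ s = 0" if "q r \<noteq> q s" for r s
  proof -
    have "(N ** (?H ** ?H)) $ r $ s = N $ r $ s * q s" "(?H ** ?H ** N) $ r $ s = q r * N $ r $ s"
      unfolding diag by (simp_all add: matrix_matrix_mult_def if_distrib if_distribR cong: if_cong)
    then show ?thesis using comm that by (simp add: mult.commute)
  qed
  show ?thesis
  proof (rule so8_eqI[OF assms(1) block_embed_in_so8])
    fix j :: nat assume j: "j \<in> {1..7}"
    have "block_coords N j = (if j = 1 then block_coords N 1 else 0)"
      by (rule interval_1_7_cases[OF j]) (simp_all add: vec_eq_iff forall_4 block_coords_nth ix_simps * q)
    then show "block_coords N j = block_coords (block_embed 1 (block_coords N 1)) j"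
      unfolding block_embed_def block_coords_so8_of[OF j] by simp
  qed
qed

section \<open>The relations on the first summand\<close>

definition triality_relations :: "mat8 \<Rightarrow> bool" where
  "triality_relations M \<longleftrightarrow>
      trace (mat_power (so8_sigma M) 2) = trace (mat_power M 2)
       \<and> trace (mat_power (so8_sigma M) 4) =
           3/8 * (trace (mat_power M 2))^2 - 1/2 * trace (mat_power M 4) - 12 * Pf M
       \<and> Pf (so8_sigma M) =
           - (1/64) * (trace (mat_power M 2))^2 + 1/16 * trace (mat_power M 4) - 1/2 * Pf M
       \<and> trace (mat_power (so8_sigma M) 6) =
           15/64 * (trace (mat_power M 2))^3 - 15/16 * trace (mat_power M 2) * trace (mat_power M 4)
           - 15/2 * trace (mat_power M 2) * Pf M + trace (mat_power M 6)"

text \<open>The square of the matrix is diagonal with each \<open>- (y $ k)^2\<close> occurring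
  twice, and even powers are powers of this square.\<close>

lemma trace_mat_power_block_embed_1:
  "trace (mat_power (block_embed 1 y) 2) = - 2 * ((y $ 1)^2 + (y $ 2)^2 + (y $ 3)^2 + (y $ 4)^2)"
  "trace (mat_power (block_embed 1 y) 4) = 2 * ((y $ 1)^4 + (y $ 2)^4 + (y $ 3)^4 + (y $ 4)^4)"
  "trace (mat_power (block_embed 1 y) 6) = - 2 * ((y $ 1)^6 + (y $ 2)^6 + (y $ 3)^6 + (y $ 4)^6)"
proof -
  let ?Y = "block_embed 1 y"
  define d where "d = (\<chi> r. (?Y ** ?Y) $ r $ r)"
  have diag: "?Y ** ?Y = (\<chi> r s. if r = s then d $ r else 0)"
    by (simp add: d_def vec_eq_iff forall_8 matrix_mult_8_nth block_embed_def so8_of_entries)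
  have d: "d $ 0 = - ((y $ 1)^2)" "d $ 1 = - ((y $ 1)^2)" "d $ 2 = - ((y $ 2)^2)" "d $ 4 = - ((y $ 2)^2)"
    "d $ 3 = - ((y $ 3)^2)" "d $ 7 = - ((y $ 3)^2)" "d $ 5 = - ((y $ 4)^2)" "d $ 6 = - ((y $ 4)^2)"
    by (simp_all add: d_def matrix_mult_8_nth block_embed_def so8_of_entries power2_eq_square)
  have diag_mult: "(\<chi> r s. if r = s then a r else 0) ** (\<chi> r s. if r = s then b r else 0)
    = (\<chi> r s. if r = s then a r * b r else 0)" for a b :: "8 \<Rightarrow> complex"
    by (simp add: vec_eq_iff matrix_matrix_mult_def if_distrib[of "\<lambda>x. x * _"] cong: if_cong)
  have "mat_power ?Y (2 * k) = (\<chi> r s. if r = s then (d $ r) ^ k else 0)" for k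
  proof (induction k)
    case (Suc k)
    have "mat_power ?Y (2 * Suc k) = ?Y ** ?Y ** mat_power ?Y (2 * k)"
      by (simp add: mat_power_Suc matrix_mul_assoc)
    then show ?case unfolding Suc.IH diag diag_mult by (simp only: power_Suc)
  qed (simp only: mat_power_0 mat_def mult_0_right power_0)
  then have "trace (mat_power ?Y (2 * k)) = (\<Sum>r\<in>UNIV. (d $ r) ^ k)" for k
    by (simp add: trace_def)
  from this[of 1] this[of 2] this[of 3] show
    "trace (mat_power ?Y 2) = - 2 * ((y $ 1)^2 + (y $ 2)^2 + (y $ 3)^2 + (y $ 4)^2)"
    "trace (mat_power ?Y 4) = 2 * ((y $ 1)^4 + (y $ 2)^4 + (y $ 3)^4 + (y $ 4)^4)"
    "trace (mat_power ?Y 6) = - 2 * ((y $ 1)^6 + (y $ 2)^6 + (y $ 3)^6 + (y $ 4)^6)"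
    by (simp_all add: sum_8 d flip: power_mult)
qed

text \<open>These combinations are even in \<open>u\<close> and in \<open>v\<close>, hence
  polynomials in the squares. Together with \<open>pair_powers\<close> this keeps the final
  identities at low degree.\<close>

lemma half_sum_diff_powers:
  fixes u v :: complex
  assumes "U = u\<^sup>2" "V = v\<^sup>2"
  shows "((u + v) / 2)\<^sup>2 + ((u - v) / 2)\<^sup>2 = (U + V) / 2"
    and "((u + v) / 2)^4 + ((u - v) / 2)^4 = (U\<^sup>2 + 6 * U * V + V\<^sup>2) / 8"
    and "((u + v) / 2)^6 + ((u - v) / 2)^6 = (U^3 + 15 * U\<^sup>2 * V + 15 * U * V\<^sup>2 + V^3) / 32"
    and "(u + v) / 2 * ((u - v) / 2) = (U - V) / 4"
  unfolding assms by (simp add: field_simps eval_nat_numeral)+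

lemma pair_powers:
  fixes a b :: complex
  assumes "P = a\<^sup>2 + b\<^sup>2" "p = a * b"
  shows "a^4 + b^4 = P\<^sup>2 - 2 * p\<^sup>2" "a^6 + b^6 = P^3 - 3 * P * p\<^sup>2"
    "(a + b)\<^sup>2 = P + 2 * p" "(a - b)\<^sup>2 = P - 2 * p"
  unfolding assms by (simp_all add: field_simps eval_nat_numeral)

text \<open>Up to sign, \<sigma> takes half-sum and half-difference of \<open>a + b\<close> and
  \<open>c + d\<close>, and likewise of \<open>a - b\<close> and \<open>c - d\<close>. All
  invariants thus become polynomials in \<open>P\<close>, \<open>p\<close>, \<open>Q\<close>,
  \<open>q\<close>.\<close>

lemma triality_relations_block_embed_1: "triality_relations (block_embed 1 y)"
proof -
  define a b c d where abcd: "a = y $ 1" "b = y $ 2" "c = y $ 3" "d = y $ 4"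
  define x where "x = sigma_matrix *v y"
  define P p Q q where def: "P = a\<^sup>2 + b\<^sup>2" "p = a * b" "Q = c\<^sup>2 + d\<^sup>2" "q = c * d"
  note ab = pair_powers[OF def(1,2)] and cd = pair_powers[OF def(3,4)]
  have x: "x $ 1 = - (((a + b) + (c + d)) / 2)" "x $ 2 = ((a + b) - (c + d)) / 2"
    "x $ 3 = ((a - b) + (c - d)) / 2" "x $ 4 = ((a - b) - (c - d)) / 2"
    by (simp_all add: x_def matrix_vector_mult_def sum_4 sigma_matrix_entries abcd field_simps)
  note x12 = half_sum_diff_powers[OF ab(3)[symmetric] cd(3)[symmetric]]
    and x34 = half_sum_diff_powers[OF ab(4)[symmetric] cd(4)[symmetric]]
  have y2: "(y $ 1)\<^sup>2 + (y $ 2)\<^sup>2 + (y $ 3)\<^sup>2 + (y $ 4)\<^sup>2 = P + Q"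
    by (simp add: def abcd)
  have y4: "(y $ 1)^4 + (y $ 2)^4 + (y $ 3)^4 + (y $ 4)^4 = P\<^sup>2 - 2 * p\<^sup>2 + (Q\<^sup>2 - 2 * q\<^sup>2)"
    unfolding ab[symmetric] cd[symmetric] abcd by (simp only: add.assoc)
  have y6: "(y $ 1)^6 + (y $ 2)^6 + (y $ 3)^6 + (y $ 4)^6 = P^3 - 3 * P * p\<^sup>2 + (Q^3 - 3 * Q * q\<^sup>2)"
    unfolding ab[symmetric] cd[symmetric] abcd by (simp only: add.assoc)
  have yP: "y $ 1 * y $ 2 * y $ 3 * y $ 4 = p * q"
    by (simp add: def abcd)
  \<comment> \<open>The first two and the last two coordinates are grouped so that the rules for
    half-sums and half-differences match.\<close>
  have regroup: "s + t + u + v = (s + t) + (u + v)" "s * t * u * v = (s * t) * (u * v)" for s t u v :: complex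
    by (simp_all only: add.assoc mult.assoc)
  have x2: "(x $ 1)\<^sup>2 + (x $ 2)\<^sup>2 + (x $ 3)\<^sup>2 + (x $ 4)\<^sup>2 = P + Q"
    unfolding regroup(1)[of "(x $ 1)\<^sup>2"] unfolding x power_minus_even[OF even_numeral] x12 x34 by (simp add: field_simps)
  have x4: "(x $ 1)^4 + (x $ 2)^4 + (x $ 3)^4 + (x $ 4)^4 =
      ((P + 2 * p)\<^sup>2 + 6 * (P + 2 * p) * (Q + 2 * q) + (Q + 2 * q)\<^sup>2) / 8 +
      ((P - 2 * p)\<^sup>2 + 6 * (P - 2 * p) * (Q - 2 * q) + (Q - 2 * q)\<^sup>2) / 8"
    unfolding regroup(1)[of "(x $ 1)^4"] unfolding x power_minus_even[OF even_numeral] x12 x34 ..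
  have x6: "(x $ 1)^6 + (x $ 2)^6 + (x $ 3)^6 + (x $ 4)^6 =
      ((P + 2 * p)^3 + 15 * (P + 2 * p)\<^sup>2 * (Q + 2 * q) + 15 * (P + 2 * p) * (Q + 2 * q)\<^sup>2 + (Q + 2 * q)^3) / 32 +
      ((P - 2 * p)^3 + 15 * (P - 2 * p)\<^sup>2 * (Q - 2 * q) + 15 * (P - 2 * p) * (Q - 2 * q)\<^sup>2 + (Q - 2 * q)^3) / 32"
    unfolding regroup(1)[of "(x $ 1)^6"] unfolding x power_minus_even[OF even_numeral] x12 x34 ..
  have xP: "x $ 1 * x $ 2 * x $ 3 * x $ 4 = - ((P + 2 * p - (Q + 2 * q)) / 4 * ((P - 2 * p - (Q - 2 * q)) / 4))"
    unfolding regroup(2)[of "x $ 1"] unfolding x mult_minus_left x12 x34 ..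
  have 1: "(1::nat) \<in> {1..7}" by simp
  show ?thesis
    unfolding triality_relations_def so8_sigma_block_embed[OF 1] trace_mat_power_block_embed_1
      Pf_block_embed_1 x_def[symmetric] x2 x4 x6 xP y2 y4 y6 yP
    by (intro conjI refl; simp add: field_simps power2_eq_square power3_eq_cube)
qed

text \<open>A maximiser on the compact set \<open>isospectral M\<close> lies in the first summand,
  where the relations are known, and it shares all invariants with \<open>M\<close>.\<close>

lemma triality_relations_real:
  assumes "M \<in> so8" "real_mat M"
  shows "triality_relations M"
proof -
  have "M \<in> isospectral M" using assms by (simp add: isospectral_def)
  moreover have "continuous_on (isospectral M) (\<lambda>N. Re (trace (regular_element ** N)))"
    by (intro continuous_intros)
  ultimately obtain N where N: "N \<in> isospectral M"
    "\<forall>N'\<in>isospectral M. Re (trace (regular_element ** N')) \<le> Re (trace (regular_element ** N))"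
    using continuous_attains_sup[OF compact_isospectral] by blast
  have "N = block_embed 1 (block_coords N 1)"
    using N by (intro regular_element_centralizer commutator_regular_element_eq_0)
      (auto simp: isospectral_def)
  then have "triality_relations N" using triality_relations_block_embed_1 by metis
  moreover have "trace (mat_power M k) = trace (mat_power N k)" "Pf M = Pf N"
    "trace (mat_power (so8_sigma M) k) = trace (mat_power (so8_sigma N) k)" "Pf (so8_sigma M) = Pf (so8_sigma N)" for k
    using N(1) unfolding isospectral_def by simp_all
  ultimately show ?thesis unfolding triality_relations_def by (simp only:)
qed

section \<open>From real to complex matrices\<close>

lemma holomorphic_on_mat_mult:
  assumes "\<And>i j. (\<lambda>z. A z $ i $ j) holomorphic_on S" "\<And>i j. (\<lambda>z. B z $ i $ j) holomorphic_on S"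
  shows "(\<lambda>z. (A z ** B z) $ i $ j) holomorphic_on S"
  unfolding matrix_matrix_mult_def vec_lambda_beta
  by (intro holomorphic_on_sum holomorphic_on_mult assms)

lemma holomorphic_on_trace_mat_power:
  assumes "\<And>i j. (\<lambda>z. F z $ i $ j) holomorphic_on S"
  shows "(\<lambda>z. trace (mat_power (F z) k)) holomorphic_on S"
proof -
  have "(\<lambda>z. mat_power (F z) k $ i $ j) holomorphic_on S" for i j
  proof (induction k arbitrary: i j)
    case (Suc k)
    then show ?case unfolding mat_power_Suc by (intro holomorphic_on_mat_mult assms)
  qed (simp add: mat_power_0)
  then show ?thesis unfolding trace_def by (intro holomorphic_intros)
qed

lemma holomorphic_on_Pf:
  assumes "\<And>i j. (\<lambda>z. F z $ i $ j) holomorphic_on S"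
  shows "(\<lambda>z. Pf (F z)) holomorphic_on S"
  unfolding Pf_def by (intro holomorphic_on_sum holomorphic_on_mult holomorphic_on_const assms)

text \<open>The real line accumulates at 0, so the identity theorem applies to the
  difference.\<close>

lemma eq_of_holomorphic_of_eq_on_Reals:
  assumes "f holomorphic_on UNIV" "g holomorphic_on UNIV" "\<And>t. f (of_real t) = g (of_real t)"
  shows "\<forall>z. f z = (g z :: complex)"
proof
  fix z
  have lim: "0 islimpt (\<real> :: complex set)"
    unfolding islimpt_approachable
  proof (intro allI impI)
    fix e :: real assume "e > 0"
    then show "\<exists>x'\<in>\<real>. x' \<noteq> (0 :: complex) \<and> dist x' 0 < e"
      by (intro bexI[of _ "of_real (e / 2)"]) (auto simp: norm_divide)
  qed
  have hol: "(\<lambda>z. f z - g z) holomorphic_on UNIV"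
    by (intro holomorphic_on_diff assms)
  have zero: "f z - g z = 0" if "z \<in> \<real>" for z
    using that assms(3) by (auto elim: Reals_cases)
  have "f z - g z = 0"
    by (rule analytic_continuation[OF hol open_UNIV connected_UNIV subset_UNIV UNIV_I lim zero UNIV_I])
  then show "f z = g z" by simp
qed

theorem theorem1p4:
  fixes M :: "complex^8^8"
  assumes "M \<in> so8"
  shows "trace (mat_power (so8_sigma M) 2) = trace (mat_power M 2)
       \<and> trace (mat_power (so8_sigma M) 4) =
           3/8 * (trace (mat_power M 2))^2 - 1/2 * trace (mat_power M 4) - 12 * Pf M
       \<and> Pf (so8_sigma M) =
           - (1/64) * (trace (mat_power M 2))^2 + 1/16 * trace (mat_power M 4) - 1/2 * Pf M
       \<and> trace (mat_power (so8_sigma M) 6) =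
           15/64 * (trace (mat_power M 2))^3 - 15/16 * trace (mat_power M 2) * trace (mat_power M 4)
           - 15/2 * trace (mat_power M 2) * Pf M + trace (mat_power M 6)"
proof -
  \<comment> \<open>Skew-symmetry of \<open>M\<close> passes to its entrywise real and imaginary
    parts, so \<open>F z\<close> is real and skew-symmetric for real \<open>z\<close>.\<close>
  define A :: mat8 where "A = (\<chi> i j. of_real (Re (M $ i $ j)))"
  define B :: mat8 where "B = (\<chi> i j. of_real (Im (M $ i $ j)))"
  define F where "F z = A + cmul z B" for z
  have F_i: "F \<i> = M" by (simp add: F_def A_def B_def cmul_def vec_eq_iff complex_eq_iff)
  have "triality_relations (F (of_real t))" for t
  proof (rule triality_relations_real)
    have s: "M $ j $ i = - M $ i $ j" for i j using assms so8_iff by blast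
    show "F (of_real t) \<in> so8"
      unfolding so8_iff
    proof (intro allI)
      fix i j
      show "F (of_real t) $ j $ i = - F (of_real t) $ i $ j"
        using s[of i j] by (simp add: F_def A_def B_def cmul_def)
    qed
    show "real_mat (F (of_real t))"
      by (simp add: real_mat_def F_def A_def B_def cmul_def)
  qed
  note real = this[unfolded triality_relations_def]
  have F_hol: "(\<lambda>z. F z $ i $ j) holomorphic_on UNIV" for i j
    unfolding F_def cmul_def vector_add_component vec_lambda_beta by (intro holomorphic_intros)
  \<comment> \<open>By complex linearity of \<open>so8_sigma\<close> the entries of the image remain
    affine functions of \<open>z\<close>.\<close>
  have sF_hol: "(\<lambda>z. so8_sigma (F z) $ i $ j) holomorphic_on UNIV" for i j
    unfolding F_def so8_sigma_add so8_sigma_cmul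
    unfolding cmul_def vector_add_component vec_lambda_beta
    by (intro holomorphic_intros)
  have hol: "(\<lambda>z. trace (mat_power (F z) k)) holomorphic_on UNIV" "(\<lambda>z. Pf (F z)) holomorphic_on UNIV"
    "(\<lambda>z. trace (mat_power (so8_sigma (F z)) k)) holomorphic_on UNIV" "(\<lambda>z. Pf (so8_sigma (F z))) holomorphic_on UNIV" for k
    by (rule holomorphic_on_trace_mat_power holomorphic_on_Pf, rule F_hol sF_hol)+
  have "\<forall>z. triality_relations (F z)"
    unfolding triality_relations_def all_conj_distrib
    by (intro conjI; rule eq_of_holomorphic_of_eq_on_Reals;
        (intro hol holomorphic_on_add holomorphic_on_diff holomorphic_on_mult holomorphic_on_power holomorphic_on_const)?;
        simp only: real)
  then have "triality_relations (F \<i>)" by blast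
  then show ?thesis unfolding F_i triality_relations_def .
qed

end
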